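(* Let $n$ be a power of two, let $C\in\mathbb{C}^{n\times n}$ satisfy $DC-CD=\widetilde G\widetilde H^*$ with $D=\mathrm{diag}(\omega^0,\omega^2,\ldots,\omega^{2n-2})$, $\omega=\exp(\mathrm{i}\pi/n)$ and $\widetilde G,\widetilde H\in\mathbb{C}^{n\times\rho}$. Let $X=C_{JK}$ be an $m\times m$ off-diagonal HODLR block of $C$, $m\ge2$, so that $$D_JX-XD_K=\widetilde G_J\widetilde H_K^*,$$ with a right-hand side of rank at most $\rho$. Let $k\ge1$ and let $X^{(k)}=ZW^*$ be the matrix constructed after $k$ iterations of fADI with the Zolotarev shift parameters $\{(\tau_j,\nu_j)\}_{j=1}^k$ specified in the context. Then $X^{(k)}$ has rank at most $\rho k$ and $$\|X-X^{(k)}\|_2\le 4\,\xi^{-k}\,\|X\|_2,\qquad \xi=\exp\left(\frac{\pi^2}{2\log(4m)}\right)>1 .$$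
   Context: Rows and columns are indexed from $0$. For index sets $J,K$, $C_{JK}$ is the submatrix of $C$ with rows $J$ and columns $K$; $D_J$, $D_K$ are the diagonal matrices with diagonal entries $\omega^{2j}$, $j\in J$, resp. $\omega^{2k}$, $k\in K$; $\widetilde G_J$, $\widetilde H_K$ are the corresponding rows of $\widetilde G$, $\widetilde H$. $\|\cdot\|_2$ is the spectral norm. Off-diagonal HODLR blocks: the index set $\{0,\ldots,n-1\}$ is recursively halved into consecutive halves according to a perfectly balanced binary tree. An $m\times m$ off-diagonal HODLR block is $C_{JK}$ where $J,K$ are sibling index sets, i.e. $m=n/2^\ell$ for some $\ell\ge1$ and $\{J,K\}=\{\{2qm,\ldots,(2q+1)m-1\},\{(2q+1)m,\ldots,(2q+2)m-1\}\}$ for some integer $q\ge0$. fADI with shifts $\{(\tau_j,\nu_j)\}_{j=1}^k$: set $Z_1=(\nu_1-\tau_1)(D_J-\nu_1I)^{-1}\widetilde G_J$, $W_1=(D_K^*-\overline{\tau}_1I)^{-1}\widetilde H_K$, and for $j=1,\ldots,k-1$ $$Z_{j+1}=\frac{\nu_{j+1}-\tau_{j+1}}{\nu_j-\tau_j}(D_J-\tau_jI)(D_J-\nu_{j+1}I)^{-1}Z_j,\qquad W_{j+1}=(D_K^*-\overline{\nu}_jI)(D_K^*-\overline{\tau}_{j+1}I)^{-1}W_j;$$ then $Z=[Z_1,\ldots,Z_k]$, $W=[W_1,\ldots,W_k]$ and $X^{(k)}=ZW^*$. Zolotarev shift parameters: let $k_0=\min K$, $\alpha=\frac{\pi}{n}(m-1)$,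 $\beta=\frac{\pi}{n}(m+1)$, $\theta=\frac{\pi}{n}(2k_0+m-1)$, $\mathcal A_K=\{e^{\mathrm{i}(\theta+t)}:t\in[-\alpha,\alpha]\}\supset\Lambda(D_K)$, $\mathcal A_J=\{e^{\mathrm{i}(\theta+t)}:t\in[\beta,2\pi-\beta]\}\supset\Lambda(D_J)$ ($\Lambda$ denotes the spectrum). Let $\gamma=\big(\sin\frac{\beta+\alpha}{2}/\sin\frac{\beta-\alpha}{2}\big)^2$, $\delta=-1+2\gamma+2\sqrt{\gamma^2-\gamma}$, $\Xi=\sqrt{1-1/\delta^2}$, and let $T_1$ be a Möbius transformation with $T_1([-\delta,-1])=\mathcal A_J$, $T_1([1,\delta])=\mathcal A_K$. Then $\tau_j=T_1\big(-\delta\,\mathrm{dn}[\frac{2j-1}{2k}K(\Xi),\Xi]\big)$, $\nu_j=T_1\big(\delta\,\mathrm{dn}[\frac{2j-1}{2k}K(\Xi),\Xi]\big)$, $j=1,\ldots,k$, where $K(\Xi)$ is the complete elliptic integral of the first kind and $\mathrm{dn}$ the Jacobi elliptic function, both with modulus $\Xi$. These are the zeros and poles of a rational function $r$ of type $(k,k)$ minimizing $\sup_{\mathcal A_J}|r|/\inf_{\mathcal A_K}|r|$. *)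

theory Defs
  imports
    "HOL-Analysis.Interval_Integral"
    "Jordan_Normal_Form.DL_Rank"
    "Jordan_Normal_Form.DL_Submatrix"
    "Jordan_Normal_Form.Gauss_Jordan_Elimination"
    "Jordan_Normal_Form.Schur_Decomposition"
begin

definition l2norm :: "complex vec \<Rightarrow> real" where
  "l2norm v = L2_set (\<lambda>i. cmod (vec_index v i)) {..<dim_vec v}"

definition spectral_norm :: "complex mat \<Rightarrow> real" where
  "spectral_norm A = (SUP v\<in>{v \<in> carrier_vec (dim_col A). l2norm v \<le> 1}. l2norm (A *\<^sub>v v))"

definition omega :: "nat \<Rightarrow> complex" where
  "omega n = exp (\<i> * complex_of_real (pi / real n))"

definition D_full :: "nat \<Rightarrow> complex mat" where
  "D_full n = mat_diag n (\<lambda>j. omega n ^ (2 * j))"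

(* D_sub n J is the paper's D_J; pick J i is the i-th smallest element of J, as in submatrix. *)
definition D_sub :: "nat \<Rightarrow> nat set \<Rightarrow> complex mat" where
  "D_sub n J = mat_diag (card J) (\<lambda>i. omega n ^ (2 * pick J i))"

definition hodlr_siblings :: "nat \<Rightarrow> nat \<Rightarrow> nat set \<Rightarrow> nat set \<Rightarrow> bool" where
  "hodlr_siblings n m J K \<longleftrightarrow>
     (\<exists>l\<ge>1. n = 2 ^ l * m) \<and>
     (\<exists>q. (2 * q + 2) * m \<le> n \<and>
        {J, K} = {{2 * q * m..<(2 * q + 1) * m}, {(2 * q + 1) * m..<(2 * q + 2) * m}})"

definition shifted :: "complex mat \<Rightarrow> complex \<Rightarrow> complex mat" where
  "shifted A s = A - s \<cdot>\<^sub>m 1\<^sub>m (dim_row A)"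

(* Only meaningful for invertible A; otherwise mat_inverse A is None. *)
definition inv_mat :: "complex mat \<Rightarrow> complex mat" where
  "inv_mat A = the (mat_inverse A)"

(* The iterates are numbered from 1 as in the paper; the value at 0 is unspecified. *)
fun fadi_Z :: "complex mat \<Rightarrow> complex mat \<Rightarrow> (nat \<Rightarrow> complex) \<Rightarrow> (nat \<Rightarrow> complex) \<Rightarrow> nat \<Rightarrow> complex mat"
where
  "fadi_Z A G \<tau> \<nu> (Suc 0) = (\<nu> 1 - \<tau> 1) \<cdot>\<^sub>m (inv_mat (shifted A (\<nu> 1)) * G)"
| "fadi_Z A G \<tau> \<nu> (Suc (Suc i)) =
     (let j = Suc i in
       ((\<nu> (j + 1) - \<tau> (j + 1)) / (\<nu> j - \<tau> j)) \<cdot>\<^sub>m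
         (shifted A (\<tau> j) * inv_mat (shifted A (\<nu> (j + 1))) * fadi_Z A G \<tau> \<nu> j))"

fun fadi_W :: "complex mat \<Rightarrow> complex mat \<Rightarrow> (nat \<Rightarrow> complex) \<Rightarrow> (nat \<Rightarrow> complex) \<Rightarrow> nat \<Rightarrow> complex mat"
where
  "fadi_W B H \<tau> \<nu> (Suc 0) = inv_mat (shifted (mat_adjoint B) (cnj (\<tau> 1))) * H"
| "fadi_W B H \<tau> \<nu> (Suc (Suc i)) =
     (let j = Suc i in
       shifted (mat_adjoint B) (cnj (\<nu> j)) *
         inv_mat (shifted (mat_adjoint B) (cnj (\<tau> (j + 1)))) * fadi_W B H \<tau> \<nu> j)"

(* The block row [F 1, ..., F k] of r x p blocks. *)
definition block_row :: "nat \<Rightarrow> nat \<Rightarrow> nat \<Rightarrow> (nat \<Rightarrow> complex mat) \<Rightarrow> complex mat" where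
  "block_row r p k F = Matrix.mat r (k * p) (\<lambda>(i, c). F (c div p + 1) $$ (i, c mod p))"

(* fADI applied to A X - X B = G H^*, after k steps *)
definition fadi ::
  "complex mat \<Rightarrow> complex mat \<Rightarrow> complex mat \<Rightarrow> complex mat \<Rightarrow>
     (nat \<Rightarrow> complex) \<Rightarrow> (nat \<Rightarrow> complex) \<Rightarrow> nat \<Rightarrow> complex mat"
where
  "fadi A B G H \<tau> \<nu> k =
     block_row (dim_row A) (dim_col G) k (fadi_Z A G \<tau> \<nu>) *
     mat_adjoint (block_row (dim_row B) (dim_col H) k (fadi_W B H \<tau> \<nu>))"

(* All elliptic functions below take the modulus \<kappa> (not the parameter \<kappa>^2), 0 \<le> \<kappa> < 1. *)
definition elliptic_F :: "real \<Rightarrow> real \<Rightarrow> real" where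
  "elliptic_F \<phi> \<kappa> = (LBINT t=ereal 0..ereal \<phi>. 1 / sqrt (1 - \<kappa>\<^sup>2 * (sin t)\<^sup>2))"

definition elliptic_K :: "real \<Rightarrow> real" where
  "elliptic_K \<kappa> = elliptic_F (pi / 2) \<kappa>"

definition jacobi_am :: "real \<Rightarrow> real \<Rightarrow> real" where
  "jacobi_am u \<kappa> = (THE \<phi>. elliptic_F \<phi> \<kappa> = u)"

definition jacobi_dn :: "real \<Rightarrow> real \<Rightarrow> real" where
  "jacobi_dn u \<kappa> = sqrt (1 - \<kappa>\<^sup>2 * (sin (jacobi_am u \<kappa>))\<^sup>2)"

(* The pole is sent to 0 by the convention x / 0 = 0 instead of to infinity.  This does not affect
   conditions T ` S = A with 0 \<notin> A: they still force the pole to lie outside S. *)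
definition is_moebius :: "(complex \<Rightarrow> complex) \<Rightarrow> bool" where
  "is_moebius T \<longleftrightarrow> (\<exists>a b c d. a * d - b * c \<noteq> 0 \<and> T = (\<lambda>z. (a * z + b) / (c * z + d)))"

definition arc_alpha :: "nat \<Rightarrow> nat \<Rightarrow> real" where
  "arc_alpha n m = pi / real n * (real m - 1)"

definition arc_beta :: "nat \<Rightarrow> nat \<Rightarrow> real" where
  "arc_beta n m = pi / real n * (real m + 1)"

definition arc_theta :: "nat \<Rightarrow> nat \<Rightarrow> nat set \<Rightarrow> real" where
  "arc_theta n m K = pi / real n * (2 * real (Min K) + real m - 1)"

definition arc_K :: "nat \<Rightarrow> nat \<Rightarrow> nat set \<Rightarrow> complex set" where
  "arc_K n m K = (\<lambda>t. exp (\<i> * complex_of_real (arc_theta n m K + t))) `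
     {- arc_alpha n m..arc_alpha n m}"

(* The arc containing the spectrum of D_J; like the paper's, it is determined by K. *)
definition arc_J :: "nat \<Rightarrow> nat \<Rightarrow> nat set \<Rightarrow> complex set" where
  "arc_J n m K = (\<lambda>t. exp (\<i> * complex_of_real (arc_theta n m K + t))) `
     {arc_beta n m..2 * pi - arc_beta n m}"

definition zol_gamma :: "nat \<Rightarrow> nat \<Rightarrow> real" where
  "zol_gamma n m =
     (sin ((arc_beta n m + arc_alpha n m) / 2) / sin ((arc_beta n m - arc_alpha n m) / 2))\<^sup>2"

definition zol_delta :: "nat \<Rightarrow> nat \<Rightarrow> real" where
  "zol_delta n m =
     - 1 + 2 * zol_gamma n m + 2 * sqrt ((zol_gamma n m)\<^sup>2 - zol_gamma n m)"

definition zol_Xi :: "nat \<Rightarrow> nat \<Rightarrow> real" where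
  "zol_Xi n m = sqrt (1 - 1 / (zol_delta n m)\<^sup>2)"

definition zol_moebius :: "nat \<Rightarrow> nat \<Rightarrow> nat set \<Rightarrow> (complex \<Rightarrow> complex) \<Rightarrow> bool" where
  "zol_moebius n m K T \<longleftrightarrow> is_moebius T \<and>
     T ` complex_of_real ` {- zol_delta n m..- 1} = arc_J n m K \<and>
     T ` complex_of_real ` {1..zol_delta n m} = arc_K n m K"

definition zol_dn :: "nat \<Rightarrow> nat \<Rightarrow> nat \<Rightarrow> nat \<Rightarrow> real" where
  "zol_dn n m k j =
     jacobi_dn ((2 * real j - 1) / (2 * real k) * elliptic_K (zol_Xi n m)) (zol_Xi n m)"

definition zol_tau :: "nat \<Rightarrow> nat \<Rightarrow> (complex \<Rightarrow> complex) \<Rightarrow> nat \<Rightarrow> nat \<Rightarrow> complex" where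
  "zol_tau n m T k j = T (complex_of_real (- zol_delta n m * zol_dn n m k j))"

definition zol_nu :: "nat \<Rightarrow> nat \<Rightarrow> (complex \<Rightarrow> complex) \<Rightarrow> nat \<Rightarrow> nat \<Rightarrow> complex" where
  "zol_nu n m T k j = T (complex_of_real (zol_delta n m * zol_dn n m k j))"

end

theory Submission
  imports Defs
begin

text \<open>
  On diagonal data the error of fADI is an entrywise multiplication of $X$ by
  $r(\lambda_a) / r(\mu_b)$ with $r(z) = \prod_j (z - \tau_j) / (z - \nu_j)$, and cross ratios are
  Moebius invariant, so the error factor is at most $M^2$, where $M$ is the maximum over
  $[1/\delta, 1]$ of $|R|$, $R(t) = \prod_j (t - a_j) / (t + a_j)$,
  $a_j = \mathrm{dn}((2j-1)K/2k)$.

  The function $u \mapsto R(\mathrm{dn}\,u)$ is even and changes sign under a shift by $K/k$, so all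
  critical points of $R$ are known; counting roots shows that $R$ equioscillates between $M$ and $-M$
  and satisfies the differential equation of an elliptic function with modulus $M^2$.  Integrating it
  over $[\mathrm{dn}(K/k), 1]$ and over $[-1/\delta, 1/\delta]$ gives
  $K'(M^2) / K(M^2) = 4 k\, K(1/\delta) / K(\Xi)$.  The inequality
  $\pi K'(\kappa) / (2 K(\kappa)) \le \log (4/\kappa)$, applied with $\kappa = M^2$ and with
  $\kappa = 1/\delta$, yields $M^2 \le 4 \exp(- k \pi^2 / \log (4 \delta))$, and
  $4 \delta \le (4m)^2$.
\<close>

section \<open>Jacobi elliptic functions on the real line\<close>

text \<open>The relation R(-t) = 1 / R(t) brings in the modulus M^2: it locates the zeros of 1 - M^2
  R^2 as mirror images of those of M^2 - R^2, and for y = R/M these two expressions are M^2 (1 -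
  y^2) and 1 - M^4 y^2. The differential equation contains a constant c, the multiplier of this
  degree k transformation of elliptic functions. It is never evaluated: the two integrations give 2
  K(M^2) = c K(Xi) / k and K'(M^2) = 2 c K(1/delta), and c cancels in the quotient. The second
  integration stands in for the imaginary period, so everything stays on the real line. The bound on
  K'/K serves in opposite directions: at M^2 it bounds the quotient from above by log(4/M^2), and at
  1/delta, whose complementary modulus is Xi, it bounds the quotient from below. The prefactor 4 of
  the theorem is the 4 in log(4/M^2). The passage from entries to the spectral norm rests on the
  multiplier being a function of the row times a function of the column.\<close>

locale elliptic_modulus =
  fixes \<kappa> :: real
  assumes nonneg: "0 \<le> \<kappa>" and less_1: "\<kappa> < 1"
begin

abbreviation "F \<phi> \<equiv> elliptic_F \<phi> \<kappa>"
abbreviation "KK \<equiv> elliptic_K \<kappa>"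
abbreviation "am u \<equiv> jacobi_am u \<kappa>"
abbreviation "dn u \<equiv> jacobi_dn u \<kappa>"

definition "sn u = sin (am u)"
definition "cn u = cos (am u)"

lemma square_less_1: "\<kappa>\<^sup>2 < 1"
  using nonneg less_1 by (simp add: power_less_one_iff)

lemma radicand_pos: "0 < 1 - \<kappa>\<^sup>2 * (sin \<phi>)\<^sup>2"
proof -
  have "\<kappa>\<^sup>2 * (sin \<phi>)\<^sup>2 \<le> \<kappa>\<^sup>2 * 1"
    by (intro mult_left_mono) (auto simp: abs_square_le_1)
  then show ?thesis using square_less_1 by linarith
qed

lemma F_deriv: "(F has_real_derivative 1 / sqrt (1 - \<kappa>\<^sup>2 * (sin \<phi>)\<^sup>2)) (at \<phi>)"
proof -
  have "sqrt (1 - \<kappa>\<^sup>2 * (sin y)\<^sup>2) \<noteq> 0" for y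
    using radicand_pos[of y] by simp
  then have cont: "continuous_on S (\<lambda>y. 1 / sqrt (1 - \<kappa>\<^sup>2 * (sin y)\<^sup>2))" for S
    by (intro continuous_intros) auto
  \<comment> \<open>The margin makes 0 and \<phi> interior, so the derivative within the interval is
    the two-sided one.\<close>
  let ?a = "- \<bar>\<phi>\<bar> - 1" and ?b = "\<bar>\<phi>\<bar> + 1"
  have "((\<lambda>u. LBINT y=ereal 0..ereal u. 1 / sqrt (1 - \<kappa>\<^sup>2 * (sin y)\<^sup>2))
      has_vector_derivative 1 / sqrt (1 - \<kappa>\<^sup>2 * (sin \<phi>)\<^sup>2)) (at \<phi> within {?a..?b})"
    by (intro interval_integral_FTC2 cont) auto
  moreover have "at \<phi> within {?a..?b} = at \<phi>"
    by (rule at_within_Icc_at) auto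
  ultimately show ?thesis
    by (simp add: has_real_derivative_iff_has_vector_derivative elliptic_F_def[abs_def])
qed

lemma F_deriv_chain [derivative_intros]:
  assumes "(h has_real_derivative h') (at x within S)"
  shows "((\<lambda>x. F (h x)) has_real_derivative 1 / sqrt (1 - \<kappa>\<^sup>2 * (sin (h x))\<^sup>2) * h') (at x within S)"
  by (rule DERIV_chain2[OF F_deriv assms])

lemma F_isCont: "isCont F \<phi>"
  using F_deriv DERIV_isCont by blast

lemma F_cont: "continuous_on S F"
  using F_isCont continuous_at_imp_continuous_on by blast

lemma F_0: "F 0 = 0"
  by (simp add: elliptic_F_def)

text \<open>The integrand is at least 1, so \<open>F\<close> expands distances. This yields strict
  monotonicity, the brackets in \<open>F_am\<close> and the bound \<open>KK_ge\<close>.\<close>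

lemma F_diff_ge: "y \<le> x \<Longrightarrow> x - y \<le> F x - F y"
proof (cases "y = x")
  case False
  assume "y \<le> x"
  then have "y < x" using False by simp
  then obtain z where z: "F x - F y = (x - y) * (1 / sqrt (1 - \<kappa>\<^sup>2 * (sin z)\<^sup>2))"
    using MVT2[OF \<open>y < x\<close> F_deriv] by blast
  have "sqrt (1 - \<kappa>\<^sup>2 * (sin z)\<^sup>2) \<le> 1" by simp
  then have "1 \<le> 1 / sqrt (1 - \<kappa>\<^sup>2 * (sin z)\<^sup>2)"
    using radicand_pos[of z] by simp
  then show ?thesis using z \<open>y < x\<close>
    by (metis diff_ge_0_iff_ge less_eq_real_def mult.right_neutral mult_left_mono)
qed simp

lemma F_strict_mono: "strict_mono F"
  unfolding strict_mono_def using F_diff_ge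
  by (metis diff_gt_0_iff_gt less_le_trans order_less_imp_le)

lemma F_odd: "F (- \<phi>) = - F \<phi>"
proof -
  have "((\<lambda>x. F (- x) + F x) has_real_derivative 0) (at x)" for x
    by (auto intro!: derivative_eq_intros)
  then have "F (- \<phi>) + F \<phi> = F (- 0) + F 0"
    using DERIV_isconst_all[of "\<lambda>x. F (- x) + F x"] by blast
  then show ?thesis by (simp add: F_0)
qed

lemma F_plus_pi: "F (\<phi> + pi) = F \<phi> + 2 * KK"
proof -
  have "((\<lambda>x. F (x + pi) - F x) has_real_derivative 0) (at x)" for x
    by (auto intro!: derivative_eq_intros)
  \<comment> \<open>At the base point -pi/2 oddness turns the difference into twice the complete
    integral.\<close>
  then have "F (\<phi> + pi) - F \<phi> = F (- pi / 2 + pi) - F (- pi / 2)"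
    using DERIV_isconst_all[of "\<lambda>x. F (x + pi) - F x"] by blast
  then show ?thesis using F_odd[of "pi / 2"] by (simp add: elliptic_K_def)
qed

lemma KK_ge: "pi / 2 \<le> KK"
  using F_diff_ge[of 0 "pi / 2"] by (simp add: F_0 elliptic_K_def)

lemma KK_pos: "0 < KK"
  using KK_ge pi_half_gt_zero by linarith

text \<open>This makes the \<open>THE\<close> in \<open>jacobi_am\<close> proper: a solution between
  0 and u exists by \<open>F_diff_ge\<close>, and it is unique by strict monotonicity.\<close>

lemma F_am: "F (am u) = u"
proof -
  have "\<exists>\<phi>. F \<phi> = u"
  proof (cases "0 \<le> u")
    case True
    then have "\<exists>\<phi>\<ge>0. \<phi> \<le> u \<and> F \<phi> = u"
      using F_diff_ge[of 0 u] F_isCont by (intro IVT) (auto simp: F_0)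
    then show ?thesis by blast
  next
    case False
    then have "\<exists>\<phi>\<ge>u. \<phi> \<le> 0 \<and> F \<phi> = u"
      using F_diff_ge[of u 0] F_isCont by (intro IVT) (auto simp: F_0)
    then show ?thesis by blast
  qed
  then obtain \<phi> where \<phi>: "F \<phi> = u" by blast
  then have "\<psi> = \<phi>" if "F \<psi> = u" for \<psi>
    using strict_mono_eq[OF F_strict_mono, of \<psi> \<phi>] that by simp
  with \<phi> have "am u = \<phi>"
    unfolding jacobi_am_def by (rule the_equality)
  with \<phi> show ?thesis by simp
qed

lemma am_F: "am (F \<phi>) = \<phi>"
  using F_am[of "F \<phi>"] strict_mono_eq[OF F_strict_mono] by simp

lemma am_eqI: "F \<phi> = u \<Longrightarrow> am u = \<phi>"
  using am_F by blast

lemma am_0 [simp]: "am 0 = 0"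
  by (rule am_eqI) (rule F_0)

lemma am_KK: "am KK = pi / 2"
  by (rule am_eqI) (simp add: elliptic_K_def)

lemma am_minus: "am (- u) = - am u"
  by (rule am_eqI) (simp add: F_odd F_am)

lemma am_plus: "am (u + 2 * KK) = am u + pi"
  by (rule am_eqI) (simp add: F_plus_pi F_am)

lemma am_strict_mono: "u < v \<Longrightarrow> am u < am v"
  using strict_mono_less[OF F_strict_mono, of "am u" "am v"] by (simp add: F_am)

lemma am_isCont: "isCont am u"
proof -
  have "isCont am (F (am u))"
    by (rule isCont_inverse_function2[where a="am u - 1" and b="am u + 1"])
      (auto simp: am_F F_isCont)
  then show ?thesis by (simp add: F_am)
qed

lemma dn_eq: "dn u = sqrt (1 - \<kappa>\<^sup>2 * (sn u)\<^sup>2)"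
  by (simp add: jacobi_dn_def sn_def)

lemma dn_pos: "0 < dn u"
  using radicand_pos by (simp add: jacobi_dn_def)

lemma dn_sq: "(dn u)\<^sup>2 = 1 - \<kappa>\<^sup>2 * (sn u)\<^sup>2"
  using radicand_pos[of "am u"] by (simp add: dn_eq sn_def)

lemma cn_sq: "(cn u)\<^sup>2 = 1 - (sn u)\<^sup>2"
  by (simp add: cn_def sn_def cos_squared_eq)

lemma am_deriv: "(am has_real_derivative dn u) (at u)"
proof -
  have "(am has_real_derivative inverse (1 / sqrt (1 - \<kappa>\<^sup>2 * (sin (am u))\<^sup>2))) (at u)"
    using F_deriv[of "am u"] radicand_pos[of "am u"] F_am am_isCont
    by (intro DERIV_inverse_function[where f=F and a="u - 1" and b="u + 1"]) auto
  then show ?thesis by (simp add: jacobi_dn_def)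
qed

lemma sn_deriv: "(sn has_real_derivative cn u * dn u) (at u)"
  unfolding sn_def[abs_def] cn_def by (auto intro!: derivative_eq_intros am_deriv)

lemma cn_deriv: "(cn has_real_derivative - (sn u * dn u)) (at u)"
  unfolding sn_def cn_def[abs_def] by (auto intro!: derivative_eq_intros am_deriv)

lemma dn_deriv: "(dn has_real_derivative - (\<kappa>\<^sup>2 * sn u * cn u)) (at u)"
proof -
  have "((\<lambda>u. 1 - \<kappa>\<^sup>2 * (sn u)\<^sup>2) has_real_derivative - (2 * \<kappa>\<^sup>2 * sn u * cn u * dn u)) (at u)"
    by (rule derivative_eq_intros sn_deriv refl)+ simp
  moreover have "0 < 1 - \<kappa>\<^sup>2 * (sn u)\<^sup>2"
    unfolding sn_def by (rule radicand_pos)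
  ultimately have "((\<lambda>u. sqrt (1 - \<kappa>\<^sup>2 * (sn u)\<^sup>2)) has_real_derivative
      inverse (dn u) / 2 * - (2 * \<kappa>\<^sup>2 * sn u * cn u * dn u)) (at u)"
    unfolding dn_eq[of u] by (intro DERIV_chain2[OF DERIV_real_sqrt])
  then have "(dn has_real_derivative inverse (dn u) / 2 * - (2 * \<kappa>\<^sup>2 * sn u * cn u * dn u)) (at u)"
    unfolding dn_eq[abs_def] .
  moreover have "inverse (dn u) / 2 * - (2 * \<kappa>\<^sup>2 * sn u * cn u * dn u) = - (\<kappa>\<^sup>2 * sn u * cn u)"
    using dn_pos[of u] by simp
  ultimately show ?thesis by (rule DERIV_cong)
qed

lemmas jacobi_deriv_chain [derivative_intros] =
  sn_deriv[THEN DERIV_chain2] cn_deriv[THEN DERIV_chain2] dn_deriv[THEN DERIV_chain2]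

lemma values_0 [simp]: "sn 0 = 0" "cn 0 = 1" "dn 0 = 1"
  by (auto simp: sn_def cn_def dn_eq)

lemma sn_KK [simp]: "sn KK = 1"
  by (simp add: sn_def am_KK)

lemma jacobi_minus [simp]: "sn (- u) = - sn u" "cn (- u) = cn u" "dn (- u) = dn u"
  by (auto simp: sn_def cn_def dn_eq am_minus)

lemma jacobi_plus: "sn (u + 2 * KK) = - sn u" "cn (u + 2 * KK) = - cn u" "dn (u + 2 * KK) = dn u"
  by (auto simp: sn_def cn_def dn_eq am_plus)

section \<open>Addition theorems for sn and dn\<close>

lemma denom_pos: "0 < 1 - \<kappa>\<^sup>2 * (sn u)\<^sup>2 * (sn v)\<^sup>2"
proof -
  have "(sn u)\<^sup>2 * (sn v)\<^sup>2 \<le> 1 * 1"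
    by (intro mult_mono) (auto simp: sn_def abs_square_le_1)
  then have "\<kappa>\<^sup>2 * ((sn u)\<^sup>2 * (sn v)\<^sup>2) \<le> \<kappa>\<^sup>2 * 1"
    by (intro mult_left_mono) auto
  then show ?thesis using square_less_1 by (simp add: algebra_simps)
qed

text \<open>Along the line x + y = c the quotient \<open>N / E\<close> has derivative zero. At x = c
  it equals sn c, at x = u it is the right-hand side over the denominator.\<close>

lemma sn_add:
  "sn (u + v) * (1 - \<kappa>\<^sup>2 * (sn u)\<^sup>2 * (sn v)\<^sup>2) = sn u * cn v * dn v + sn v * cn u * dn u"
proof -
  define c where "c = u + v"
  define N where "N = (\<lambda>x. sn x * cn (c - x) * dn (c - x) + sn (c - x) * cn x * dn x)"
  define E where "E = (\<lambda>x. 1 - \<kappa>\<^sup>2 * (sn x)\<^sup>2 * (sn (c - x))\<^sup>2)"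
  have E: "E x \<noteq> 0" for x
    using denom_pos[of x "c - x"] by (simp add: E_def)
  have "((\<lambda>x. N x / E x) has_real_derivative 0) (at x)" for x
  proof -
    define s1 c1 d1 s2 c2 d2 where "s1 = sn x" "c1 = cn x" "d1 = dn x"
      "s2 = sn (c - x)" "c2 = cn (c - x)" "d2 = dn (c - x)"
    note defs = this
    have r: "c1\<^sup>2 = 1 - s1\<^sup>2" "c2\<^sup>2 = 1 - s2\<^sup>2" "d1\<^sup>2 = 1 - \<kappa>\<^sup>2 * s1\<^sup>2" "d2\<^sup>2 = 1 - \<kappa>\<^sup>2 * s2\<^sup>2"
      by (auto simp: defs cn_sq dn_sq)
    define N' where "N' = c1 * d1 * c2 * d2 + s1 * s2 * d2\<^sup>2 + s1 * c2\<^sup>2 * \<kappa>\<^sup>2 * s2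
       - c2 * d2 * c1 * d1 - s2 * s1 * d1\<^sup>2 - s2 * c1\<^sup>2 * \<kappa>\<^sup>2 * s1"
    define E' where "E' = - \<kappa>\<^sup>2 * (2 * s1 * c1 * d1 * s2\<^sup>2 - 2 * s2 * c2 * d2 * s1\<^sup>2)"
    have N': "(N has_real_derivative N') (at x)"
      unfolding N_def N'_def by (rule derivative_eq_intros refl)+ (simp add: defs algebra_simps power2_eq_square)
    have E': "(E has_real_derivative E') (at x)"
      unfolding E_def E'_def by (rule derivative_eq_intros refl)+ (simp add: defs algebra_simps power2_eq_square)
    have "N' = 2 * \<kappa>\<^sup>2 * s1 * s2 * (s1\<^sup>2 - s2\<^sup>2)"
      unfolding N'_def r by (simp add: algebra_simps power2_eq_square)
    then have "N' * E x = 2 * \<kappa>\<^sup>2 * s1 * s2 * ((s1\<^sup>2 - s2\<^sup>2) * E x)"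
      by simp
    \<comment> \<open>The key cancellation: this multiple of \<open>E\<close> is a difference of
      squares, of which one factor is \<open>N\<close> and the other a factor of
      \<open>E'\<close>.\<close>
    also have "(s1\<^sup>2 - s2\<^sup>2) * E x = (s1 * c2 * d2)\<^sup>2 - (s2 * c1 * d1)\<^sup>2"
      unfolding power_mult_distrib r E_def defs[symmetric] by (simp add: algebra_simps power2_eq_square)
    also have "2 * \<kappa>\<^sup>2 * s1 * s2 * \<dots> = (s1 * c2 * d2 + s2 * c1 * d1) * (2 * \<kappa>\<^sup>2 * s1 * s2 * (s1 * c2 * d2 - s2 * c1 * d1))"
      by (simp add: algebra_simps power2_eq_square)
    also have "s1 * c2 * d2 + s2 * c1 * d1 = N x"
      by (simp add: N_def defs)
    also have "2 * \<kappa>\<^sup>2 * s1 * s2 * (s1 * c2 * d2 - s2 * c1 * d1) = E'"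
      unfolding E'_def by (simp add: algebra_simps power2_eq_square)
    finally have "N' * E x = N x * E'" .
    then show ?thesis
      by (auto intro!: derivative_eq_intros N' E' simp: E)
  qed
  then have "N u / E u = N c / E c"
    using DERIV_isconst_all by blast
  then show ?thesis
    using E[of u] by (simp add: N_def E_def c_def field_simps)
qed

text \<open>The same kind of conserved quotient as for \<open>sn_add\<close>, with the numerator
  belonging to dn.\<close>

lemma dn_add:
  "dn (u + v) * (1 - \<kappa>\<^sup>2 * (sn u)\<^sup>2 * (sn v)\<^sup>2) = dn u * dn v - \<kappa>\<^sup>2 * sn u * sn v * cn u * cn v"
proof -
  define c where "c = u + v"
  define N where "N = (\<lambda>x. dn x * dn (c - x) - \<kappa>\<^sup>2 * sn x * sn (c - x) * cn x * cn (c - x))"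
  define E where "E = (\<lambda>x. 1 - \<kappa>\<^sup>2 * (sn x)\<^sup>2 * (sn (c - x))\<^sup>2)"
  have E: "E x \<noteq> 0" for x
    using denom_pos[of x "c - x"] by (simp add: E_def)
  have "((\<lambda>x. N x / E x) has_real_derivative 0) (at x)" for x
  proof -
    define s1 c1 d1 s2 c2 d2 where "s1 = sn x" "c1 = cn x" "d1 = dn x"
      "s2 = sn (c - x)" "c2 = cn (c - x)" "d2 = dn (c - x)"
    note defs = this
    have r: "c1\<^sup>2 = 1 - s1\<^sup>2" "c2\<^sup>2 = 1 - s2\<^sup>2" "d1\<^sup>2 = 1 - \<kappa>\<^sup>2 * s1\<^sup>2" "d2\<^sup>2 = 1 - \<kappa>\<^sup>2 * s2\<^sup>2"
      by (auto simp: defs cn_sq dn_sq)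
    define N' where "N' = - \<kappa>\<^sup>2 * s1 * c1 * d2 + \<kappa>\<^sup>2 * d1 * s2 * c2
       - \<kappa>\<^sup>2 * (c1\<^sup>2 * d1 * s2 * c2 - s1 * c2\<^sup>2 * d2 * c1 - s1\<^sup>2 * s2 * d1 * c2 + s1 * s2\<^sup>2 * c1 * d2)"
    define E' where "E' = - \<kappa>\<^sup>2 * (2 * s1 * c1 * d1 * s2\<^sup>2 - 2 * s2 * c2 * d2 * s1\<^sup>2)"
    have N': "(N has_real_derivative N') (at x)"
      unfolding N_def N'_def by (rule derivative_eq_intros refl)+ (simp add: defs algebra_simps power2_eq_square)
    have E': "(E has_real_derivative E') (at x)"
      unfolding E_def E'_def by (rule derivative_eq_intros refl)+ (simp add: defs algebra_simps power2_eq_square)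
    have E_x: "d2\<^sup>2 + \<kappa>\<^sup>2 * s2\<^sup>2 * c1\<^sup>2 = E x" "d1\<^sup>2 + \<kappa>\<^sup>2 * s1\<^sup>2 * c2\<^sup>2 = E x"
      unfolding r E_def defs[symmetric] by (simp_all add: algebra_simps power2_eq_square)
    have "N' = \<kappa>\<^sup>2 * d1 * s2 * c2 * (1 - c1\<^sup>2 + s1\<^sup>2) - \<kappa>\<^sup>2 * s1 * c1 * d2 * (1 - c2\<^sup>2 + s2\<^sup>2)"
      unfolding N'_def by (simp add: algebra_simps)
    also have "\<dots> = 2 * \<kappa>\<^sup>2 * s1 * s2 * (s1 * c2 * d1 - s2 * c1 * d2)"
      unfolding r by (simp add: algebra_simps power2_eq_square)
    finally have "N' * E x = 2 * \<kappa>\<^sup>2 * s1 * s2 * (s1 * c2 * d1 - s2 * c1 * d2) * E x"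
      by (rule arg_cong)
    also have "\<dots> = 2 * \<kappa>\<^sup>2 * s1 * s2 * (s1 * c2 * d1 * E x - s2 * c1 * d2 * E x)"
      by (simp add: algebra_simps)
    \<comment> \<open>The first occurrence of \<open>E\<close> is expanded by \<open>E_x(1)\<close>,
      the second by \<open>E_x(2)\<close>; then \<open>N\<close> splits off as a factor.\<close>
    also have "s1 * c2 * d1 * E x - s2 * c1 * d2 * E x = N x * (s1 * c2 * d2 - s2 * c1 * d1)"
      unfolding E_x(1)[symmetric] by (subst (2) E_x(1), subst E_x(2)[symmetric])
        (simp add: N_def defs[symmetric] algebra_simps power2_eq_square)
    also have "2 * \<kappa>\<^sup>2 * s1 * s2 * (N x * (s1 * c2 * d2 - s2 * c1 * d1)) = N x * E'"
      unfolding E'_def by (simp add: algebra_simps power2_eq_square)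
    finally have "N' * E x = N x * E'" .
    then show ?thesis
      by (auto intro!: derivative_eq_intros N' E' simp: E)
  qed
  then have "N u / E u = N c / E c"
    using DERIV_isconst_all by blast
  then show ?thesis
    using E[of u] by (simp add: N_def E_def c_def field_simps)
qed

text \<open>A signed square root of (1 - dn u) / (1 + dn u): the tangent of half the angle with sine
  \<kappa> sn u and cosine dn u. Its antiperiod 2K, against the period 2K of dn, produces the sign
  in \<open>R_dn_plus\<close>.\<close>

definition "\<sigma> u = \<kappa> * sn u / (1 + dn u)"

lemma \<sigma>_plus: "\<sigma> (u + 2 * KK) = - \<sigma> u"
  by (simp add: \<sigma>_def jacobi_plus)

text \<open>By the addition theorems the two sn have product (s1^2 - s2^2) / E, and the two 1 + dn
  have product (d1 + d2)^2 / E, so \<open>E\<close> cancels. A factor of \<open>R\<close> at dn u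
  thereby splits into two translates of one function.\<close>

lemma \<sigma>_mult: "\<sigma> (u + a) * \<sigma> (u - a) = (dn a - dn u) / (dn a + dn u)"
proof -
  define s1 c1 d1 s2 c2 d2 where "s1 = sn u" "c1 = cn u" "d1 = dn u"
      "s2 = sn a" "c2 = cn a" "d2 = dn a"
  note defs = this
  define E where "E = 1 - \<kappa>\<^sup>2 * s1\<^sup>2 * s2\<^sup>2"
  have E: "E > 0" using denom_pos by (simp add: E_def defs)
  have r: "c1\<^sup>2 = 1 - s1\<^sup>2" "c2\<^sup>2 = 1 - s2\<^sup>2" "d1\<^sup>2 = 1 - \<kappa>\<^sup>2 * s1\<^sup>2" "d2\<^sup>2 = 1 - \<kappa>\<^sup>2 * s2\<^sup>2"
    by (auto simp: defs cn_sq dn_sq)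
  define S S' D D' where "S = sn (u + a)" "S' = sn (u - a)" "D = dn (u + a)" "D' = dn (u - a)"
  note defs' = this
  have 1: "S * E = s1 * c2 * d2 + s2 * c1 * d1" "S' * E = s1 * c2 * d2 - s2 * c1 * d1"
    "D * E = d1 * d2 - \<kappa>\<^sup>2 * s1 * s2 * c1 * c2" "D' * E = d1 * d2 + \<kappa>\<^sup>2 * s1 * s2 * c1 * c2"
    using sn_add[of u a] sn_add[of u "- a"] dn_add[of u a] dn_add[of u "- a"]
    by (auto simp: defs defs' E_def)
  have "S * S' * E * E = (S * E) * (S' * E)"
    by simp
  also have "\<dots> = (s1 * c2 * d2)\<^sup>2 - (s2 * c1 * d1)\<^sup>2"
    unfolding 1 by (simp add: algebra_simps power2_eq_square)
  also have "\<dots> = (s1\<^sup>2 - s2\<^sup>2) * E"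
    unfolding power_mult_distrib r E_def by (simp add: algebra_simps power2_eq_square)
  finally have 2: "S * S' * E = s1\<^sup>2 - s2\<^sup>2" using E by simp
  have "(1 + D) * (1 + D') * E * E = (E + D * E) * (E + D' * E)"
    by (simp add: algebra_simps)
  also have "\<dots> = E\<^sup>2 + d1\<^sup>2 * d2\<^sup>2 - \<kappa>\<^sup>2 * \<kappa>\<^sup>2 * s1\<^sup>2 * s2\<^sup>2 * c1\<^sup>2 * c2\<^sup>2 + 2 * d1 * d2 * E"
    unfolding 1 by (simp add: algebra_simps power2_eq_square)
  also have "E\<^sup>2 + d1\<^sup>2 * d2\<^sup>2 - \<kappa>\<^sup>2 * \<kappa>\<^sup>2 * s1\<^sup>2 * s2\<^sup>2 * c1\<^sup>2 * c2\<^sup>2 = (d1\<^sup>2 + d2\<^sup>2) * E"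
    unfolding r E_def by (simp add: algebra_simps power2_eq_square)
  also have "(d1\<^sup>2 + d2\<^sup>2) * E + 2 * d1 * d2 * E = (d1 + d2)\<^sup>2 * E"
    by (simp add: algebra_simps power2_eq_square)
  finally have 3: "(1 + D) * (1 + D') * E = (d1 + d2)\<^sup>2" using E by simp
  have "\<kappa>\<^sup>2 * (S * S') * (d1 + d2) * E = \<kappa>\<^sup>2 * (S * S' * E) * (d1 + d2)"
    by simp
  also have "\<kappa>\<^sup>2 * (S * S' * E) = d2\<^sup>2 - d1\<^sup>2"
    unfolding 2 r by (simp add: algebra_simps)
  also have "(d2\<^sup>2 - d1\<^sup>2) * (d1 + d2) = (d2 - d1) * (d1 + d2)\<^sup>2"
    by (simp add: algebra_simps power2_eq_square)
  finally have "\<kappa>\<^sup>2 * (S * S') * (d1 + d2) = (d2 - d1) * ((1 + D) * (1 + D'))"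
    using E unfolding 3[symmetric] by simp
  moreover have "1 + D > 0" "1 + D' > 0" "d1 + d2 > 0"
    using dn_pos by (auto simp: defs defs' add_pos_pos)
  ultimately show ?thesis
    unfolding \<sigma>_def defs[symmetric] defs'[symmetric]
    by (simp add: frac_eq_eq power2_eq_square) (simp add: algebra_simps)
qed

lemma dn_anti: "0 < \<kappa> \<Longrightarrow> 0 \<le> u \<Longrightarrow> u < v \<Longrightarrow> v \<le> KK \<Longrightarrow> dn v < dn u"
proof -
  assume *: "0 < \<kappa>" "0 \<le> u" "u < v" "v \<le> KK"
  have "am 0 \<le> am u" "am u < am v" "am v \<le> am KK"
    using * am_strict_mono by (metis less_eq_real_def)+
  then have "sn u < sn v" "0 \<le> sn u"
    unfolding sn_def by (auto simp: am_KK sin_mono_less_eq intro!: sin_ge_zero)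
  then have "(sn u)\<^sup>2 < (sn v)\<^sup>2" by (intro power_strict_mono) auto
  then show ?thesis using * by (simp add: dn_eq)
qed

end

section \<open>The Landen transformation and the quotient of complete elliptic integrals\<close>

text \<open>The substitution \<open>y\<close> is Gauss's form of the Landen transformation; it
  matches 1 + a times the integrand of modulus a with the integrand of modulus 2 sqrt a / (1 + a).
  As arcsin is not differentiable at 1, the difference \<open>h\<close> is differentiated in the
  open interval and the ends are reached by continuity.\<close>

lemma elliptic_K_landen:
  assumes "0 < a" "a < 1"
  shows "elliptic_K (2 * sqrt a / (1 + a)) = (1 + a) * elliptic_K a"
proof -
  define \<kappa> where "\<kappa> = 2 * sqrt a / (1 + a)"
  have "0 < (1 - sqrt a)\<^sup>2" using assms by simp
  then have "\<kappa> < 1"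
    using assms by (simp add: \<kappa>_def power2_eq_square algebra_simps)
  then interpret k: elliptic_modulus \<kappa>
    using assms by unfold_locales (auto simp: \<kappa>_def)
  interpret a: elliptic_modulus a
    using assms by unfold_locales auto
  define y where "y = (\<lambda>\<phi>. (1 + a) * sin \<phi> / (1 + a * (sin \<phi>)\<^sup>2))"
  have pos: "0 < 1 + a * (sin \<phi>)\<^sup>2" for \<phi>
    using assms by (simp add: add_pos_nonneg)
  have ne: "1 + a * (sin \<phi>)\<^sup>2 \<noteq> 0" for \<phi>
    using pos[of \<phi>] by simp
  have 1: "1 - (y \<phi>)\<^sup>2 = (cos \<phi>)\<^sup>2 * (1 - a\<^sup>2 * (sin \<phi>)\<^sup>2) / (1 + a * (sin \<phi>)\<^sup>2)\<^sup>2" for \<phi>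
    using ne[of \<phi>] unfolding y_def cos_squared_eq power_divide
    by (simp add: divide_simps) (simp add: algebra_simps power2_eq_square)
  have \<kappa>2: "\<kappa>\<^sup>2 = 4 * a / (1 + a)\<^sup>2"
    using assms by (simp add: \<kappa>_def power_divide power_mult_distrib)
  have 2: "1 - \<kappa>\<^sup>2 * (y \<phi>)\<^sup>2 = ((1 - a * (sin \<phi>)\<^sup>2) / (1 + a * (sin \<phi>)\<^sup>2))\<^sup>2" for \<phi>
    using ne[of \<phi>] assms unfolding y_def \<kappa>2 power_divide power_mult_distrib
    by (simp add: divide_simps) (simp add: algebra_simps power2_eq_square)
  have "0 \<le> 1 - (y \<phi>)\<^sup>2" for \<phi>
    unfolding 1 using a.radicand_pos[of \<phi>] by simp
  then have y_abs: "\<bar>y \<phi>\<bar> \<le> 1" for \<phi>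
    by (simp add: abs_square_le_1[symmetric])
  have y_deriv: "(y has_real_derivative (1 + a) * cos \<phi> * (1 - a * (sin \<phi>)\<^sup>2) / (1 + a * (sin \<phi>)\<^sup>2)\<^sup>2) (at \<phi>)" for \<phi>
    unfolding y_def using ne[of \<phi>]
    by (auto intro!: derivative_eq_intros simp: divide_simps)
      (simp add: algebra_simps power2_eq_square)
  define h where "h = (\<lambda>\<phi>. k.F (arcsin (y \<phi>)) - (1 + a) * a.F \<phi>)"
  have "continuous_on {0..pi/2} y"
    using y_deriv by (meson DERIV_isCont continuous_at_imp_continuous_on)
  then have "continuous_on {0..pi/2} (\<lambda>\<phi>. arcsin (y \<phi>))"
    using y_abs by (intro continuous_on_arcsin) (auto simp: abs_le_iff)
  then have "continuous_on {0..pi/2} h"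
    unfolding h_def by (intro continuous_intros a.F_cont continuous_on_compose2[OF k.F_cont[of UNIV] \<open>continuous_on _ (\<lambda>\<phi>. arcsin (y \<phi>))\<close>]) auto
  moreover have "(h has_real_derivative 0) (at \<phi>)" if "0 < \<phi>" "\<phi> < pi / 2" for \<phi>
  proof -
    have c: "0 < cos \<phi>" using that by (intro cos_gt_zero) auto
    define s where "s = sin \<phi>"
    have "0 < 1 - (y \<phi>)\<^sup>2"
      unfolding 1 using a.radicand_pos[of \<phi>] c pos[of \<phi>] by simp
    then have y1: "- 1 < y \<phi>" "y \<phi> < 1"
      by (simp_all add: abs_square_less_1 abs_less_iff)
    \<comment> \<open>Fixes the sign of the square root in \<open>r2\<close>, whose radicand is a
      square by \<open>2\<close>.\<close>
    have s: "a * s\<^sup>2 < 1"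
    proof -
      have "a * s\<^sup>2 \<le> a" using assms unfolding s_def
        by (intro mult_left_le) (auto simp: abs_square_le_1)
      then show ?thesis using assms by linarith
    qed
    have r1: "sqrt (1 - (y \<phi>)\<^sup>2) = cos \<phi> * sqrt (1 - a\<^sup>2 * s\<^sup>2) / (1 + a * s\<^sup>2)"
      unfolding 1 using c pos[of \<phi>] by (simp add: real_sqrt_divide real_sqrt_mult s_def)
    have r2: "sqrt (1 - \<kappa>\<^sup>2 * (y \<phi>)\<^sup>2) = (1 - a * s\<^sup>2) / (1 + a * s\<^sup>2)"
      unfolding 2 using pos[of \<phi>] s by (simp add: real_sqrt_abs s_def)
    have "((\<lambda>\<phi>. arcsin (y \<phi>)) has_real_derivative inverse (sqrt (1 - (y \<phi>)\<^sup>2)) *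
        ((1 + a) * cos \<phi> * (1 - a * s\<^sup>2) / (1 + a * s\<^sup>2)\<^sup>2)) (at \<phi>)"
      unfolding s_def by (rule DERIV_chain2[OF DERIV_arcsin[OF y1] y_deriv])
    from k.F_deriv_chain[OF this]
    have "((\<lambda>\<phi>. k.F (arcsin (y \<phi>))) has_real_derivative 1 / sqrt (1 - \<kappa>\<^sup>2 * (y \<phi>)\<^sup>2) *
        (inverse (sqrt (1 - (y \<phi>)\<^sup>2)) * ((1 + a) * cos \<phi> * (1 - a * s\<^sup>2) / (1 + a * s\<^sup>2)\<^sup>2))) (at \<phi>)"
      using y1 by simp
    moreover have "((\<lambda>\<phi>. (1 + a) * a.F \<phi>) has_real_derivative (1 + a) * (1 / sqrt (1 - a\<^sup>2 * s\<^sup>2))) (at \<phi>)"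
      unfolding s_def by (intro DERIV_cmult a.F_deriv)
    moreover have "1 / sqrt (1 - \<kappa>\<^sup>2 * (y \<phi>)\<^sup>2) *
        (inverse (sqrt (1 - (y \<phi>)\<^sup>2)) * ((1 + a) * cos \<phi> * (1 - a * s\<^sup>2) / (1 + a * s\<^sup>2)\<^sup>2))
        = (1 + a) * (1 / sqrt (1 - a\<^sup>2 * s\<^sup>2))"
      unfolding r1 r2 using c s ne[of \<phi>, folded s_def]
      by (simp add: divide_simps power2_eq_square)
    ultimately show ?thesis
      unfolding h_def using DERIV_diff by fastforce
  qed
  ultimately have "h (pi / 2) = h 0"
    by (intro DERIV_isconst_end) auto
  moreover have "y (pi / 2) = 1" "y 0 = 0"
    using assms by (auto simp: y_def)
  ultimately show ?thesis
    by (simp add: h_def a.F_0 k.F_0 elliptic_K_def flip: \<kappa>_def)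
qed

text \<open>Near pi/2 the integrand 1 / \<Delta> is governed by the derivative of -ln (cos \<phi> +
  \<Delta>), which yields the logarithm. The rest is at most 2 pointwise, whence the term 2 \<phi>
  in \<open>B\<close> and the summand pi. The values of \<open>B\<close> at the ends are -ln 2 and
  -ln \<kappa> + pi - K.\<close>

lemma elliptic_K_complement_le:
  assumes "0 < \<kappa>" "\<kappa> < 1"
  shows "elliptic_K (sqrt (1 - \<kappa>\<^sup>2)) \<le> ln (2 / \<kappa>) + pi"
proof -
  have \<kappa>2: "0 < \<kappa>\<^sup>2" "\<kappa>\<^sup>2 < 1"
    using assms by (auto simp: power_less_one_iff)
  interpret k: elliptic_modulus "sqrt (1 - \<kappa>\<^sup>2)"
    using assms \<kappa>2 by unfold_locales (auto simp: real_sqrt_lt_1_iff)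
  define \<Delta> where "\<Delta> = (\<lambda>\<phi>. sqrt ((cos \<phi>)\<^sup>2 + \<kappa>\<^sup>2 * (sin \<phi>)\<^sup>2))"
  define B where "B = (\<lambda>\<phi>. - ln (cos \<phi> + \<Delta> \<phi>) + 2 * \<phi> - k.F \<phi>)"
  have rad: "1 - (sqrt (1 - \<kappa>\<^sup>2))\<^sup>2 * (sin \<phi>)\<^sup>2 = (cos \<phi>)\<^sup>2 + \<kappa>\<^sup>2 * (sin \<phi>)\<^sup>2" for \<phi>
    using \<kappa>2 by (simp add: cos_squared_eq algebra_simps)
  have "B 0 \<le> B (pi / 2)"
  proof (rule DERIV_nonneg_imp_nondecreasing[where f=B and a=0 and b="pi / 2"])
    fix \<phi> :: real
    assume \<phi>: "0 \<le> \<phi>" "\<phi> \<le> pi / 2"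
    define s c D where "s = sin \<phi>" "c = cos \<phi>" "D = \<Delta> \<phi>"
    note defs = this
    have s: "0 \<le> s" "s \<le> 1" and c: "0 \<le> c"
      using \<phi> by (auto simp: defs intro!: sin_ge_zero cos_ge_zero)
    have rad_pos: "0 < c\<^sup>2 + \<kappa>\<^sup>2 * s\<^sup>2"
      using k.radicand_pos[of \<phi>] unfolding rad defs .
    then have D: "0 < D" "D\<^sup>2 = c\<^sup>2 + \<kappa>\<^sup>2 * s\<^sup>2"
      by (auto simp: defs \<Delta>_def)
    have D': "(\<Delta> has_real_derivative inverse D / 2 * (2 * (\<kappa>\<^sup>2 - 1) * s * c)) (at \<phi>)"
      unfolding \<Delta>_def defs using rad_pos
      by (intro DERIV_chain2[OF DERIV_real_sqrt])
        (auto intro!: derivative_eq_intros simp: defs algebra_simps)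
    have F': "(k.F has_real_derivative 1 / D) (at \<phi>)"
      using k.F_deriv[of \<phi>] unfolding rad by (simp add: defs \<Delta>_def)
    have "((\<lambda>\<phi>. cos \<phi> + \<Delta> \<phi>) has_real_derivative - s + inverse D / 2 * (2 * (\<kappa>\<^sup>2 - 1) * s * c)) (at \<phi>)"
      unfolding defs(1) by (intro DERIV_add DERIV_cos D'[unfolded defs(1)])
    then have "((\<lambda>\<phi>. ln (cos \<phi> + \<Delta> \<phi>)) has_real_derivative
        inverse (c + D) * (- s + inverse D / 2 * (2 * (\<kappa>\<^sup>2 - 1) * s * c))) (at \<phi>)"
      unfolding defs(2,3)
      by (intro DERIV_chain2[where f=ln] DERIV_ln) (use c D in \<open>auto simp: defs\<close>)
    moreover have "((\<lambda>\<phi>. 2 * \<phi>) has_real_derivative 2) (at \<phi>)"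
      using DERIV_cmult_Id by blast
    ultimately have B': "(B has_real_derivative - (inverse (c + D) * (- s + inverse D / 2 * (2 * (\<kappa>\<^sup>2 - 1) * s * c))) + 2 - 1 / D) (at \<phi>)"
      unfolding B_def by (intro DERIV_diff DERIV_add DERIV_minus F')
    have "- s + inverse D / 2 * (2 * (\<kappa>\<^sup>2 - 1) * s * c) = (\<kappa>\<^sup>2 * s * c - s * (c + D)) / D"
      using D(1) by (simp add: field_simps)
    then have "inverse (c + D) * (- s + inverse D / 2 * (2 * (\<kappa>\<^sup>2 - 1) * s * c)) =
        (\<kappa>\<^sup>2 * s * c - s * (c + D)) / (D * (c + D))"
      by (simp only: divide_inverse inverse_mult_distrib) (simp only: mult_ac)
    \<comment> \<open>The rest of the integrand consists of two terms, each at most 1: one because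
      (1 - s)^2 \<le> c^2, the other by the inequality of arithmetic and geometric means.\<close>
    then have eq: "- (inverse (c + D) * (- s + inverse D / 2 * (2 * (\<kappa>\<^sup>2 - 1) * s * c))) + 2 - 1 / D
      = (1 - \<kappa>\<^sup>2 * s * c / (D * (c + D))) + (1 - (1 - s) / D)"
      using c D(1) by (simp add: diff_divide_distrib)
    have "(1 - s) / D \<le> 1"
    proof -
      have "(1 - s)\<^sup>2 \<le> (1 - s) * (1 + s)"
        using s unfolding power2_eq_square by (intro mult_left_mono) auto
      also have "\<dots> = c\<^sup>2"
        by (simp add: defs cos_squared_eq algebra_simps power2_eq_square)
      also have "\<dots> \<le> D\<^sup>2"
        unfolding D by simp
      finally show ?thesis
        using D power2_le_imp_le[of "1 - s" D] by simp
    qed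
    moreover have "\<kappa>\<^sup>2 * s * c / (D * (c + D)) \<le> 1"
    proof -
      have "0 \<le> (c - \<kappa> * s)\<^sup>2" by simp
      then have "2 * (\<kappa> * s * c) \<le> D\<^sup>2"
        unfolding D by (simp add: power2_eq_square algebra_simps)
      moreover have "\<kappa> * (\<kappa> * s * c) \<le> 1 * (\<kappa> * s * c)"
        using assms s c by (intro mult_right_mono) auto
      moreover have "0 \<le> \<kappa> * s * c" "0 \<le> D * c"
        using assms s c D by auto
      ultimately have "\<kappa>\<^sup>2 * s * c \<le> D * (c + D)"
        by (simp add: power2_eq_square algebra_simps)
      then show ?thesis
        using D c by (simp add: divide_le_eq)
    qed
    ultimately have "0 \<le> (1 - \<kappa>\<^sup>2 * s * c / (D * (c + D))) + (1 - (1 - s) / D)"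
      by linarith
    with B' show "\<exists>y. (B has_real_derivative y) (at \<phi>) \<and> 0 \<le> y"
      unfolding eq by blast
  qed simp
  then show ?thesis
    using assms by (simp add: B_def \<Delta>_def k.F_0 elliptic_K_def ln_div)
qed

text \<open>The Landen transformation doubles the left-hand side and at most doubles the right-hand side, so a
  violation would grow geometrically; the crude bound \<open>elliptic_K_complement_le\<close> excludes this.\<close>

lemma elliptic_K_ratio_le:
  assumes "0 < \<kappa>" "\<kappa> < 1"
  shows "pi * elliptic_K (sqrt (1 - \<kappa>\<^sup>2)) / (2 * elliptic_K \<kappa>) \<le> ln (4 / \<kappa>)"
proof -
  define f where "f = (\<lambda>\<kappa>. pi * elliptic_K (sqrt (1 - \<kappa>\<^sup>2)) / (2 * elliptic_K \<kappa>))"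
  define g where "g = (\<lambda>\<kappa>. ln (4 / \<kappa>) - f \<kappa>)"
  have K_ge: "pi / 2 \<le> elliptic_K x" if "0 \<le> x" "x < 1" for x
  proof -
    interpret elliptic_modulus x using that by unfold_locales
    show ?thesis by (rule KK_ge)
  qed
  \<comment> \<open>Since pi / (2 K(x)) is at most 1, the crude bound on the complementary integral
    is a bound on \<open>f\<close>.\<close>
  have lower: "- pi \<le> g x" if x: "0 < x" "x < 1" for x
  proof -
    have x2: "0 < x\<^sup>2" "x\<^sup>2 < 1" using x by (auto simp: power_less_one_iff)
    have "f x = elliptic_K (sqrt (1 - x\<^sup>2)) * ((pi / 2) / elliptic_K x)"
      by (simp add: f_def)
    also have "\<dots> \<le> elliptic_K (sqrt (1 - x\<^sup>2)) * 1"
    proof (rule mult_left_mono)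
      have "0 < elliptic_K x" using K_ge[of x] x pi_half_gt_zero by linarith
      then show "pi / 2 / elliptic_K x \<le> 1" using K_ge[of x] x by (simp add: divide_le_eq)
      show "0 \<le> elliptic_K (sqrt (1 - x\<^sup>2))"
        using K_ge[of "sqrt (1 - x\<^sup>2)"] x x2 pi_gt_zero by (simp add: real_sqrt_lt_1_iff del: pi_gt_zero)
    qed
    also have "\<dots> \<le> ln (2 / x) + pi"
      using elliptic_K_complement_le[OF x] by simp
    also have "ln (2 / x) \<le> ln (4 / x)"
      using x by (simp add: divide_le_cancel)
    finally show ?thesis by (simp add: g_def)
  qed
  have step: "\<exists>y. 0 < y \<and> y < 1 \<and> g y \<le> 2 * g x" if x: "0 < x" "x < 1" for x
  proof -
    have x2: "0 < x\<^sup>2" "x\<^sup>2 < 1" using x by (auto simp: power_less_one_iff)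
    define x' where "x' = sqrt (1 - x\<^sup>2)"
    \<comment> \<open>The descending Landen modulus: x is the ascending transform of y, and sqrt (1
      - y^2) is that of x', so \<open>elliptic_K_landen\<close> handles both complete
      integrals.\<close>
    define y where "y = (1 - x') / (1 + x')"
    have x': "0 < x'" "x' < 1" "x'\<^sup>2 = 1 - x\<^sup>2"
      using x2 by (auto simp: x'_def real_sqrt_lt_1_iff)
    have y: "0 < y" "y < 1"
      using x' by (auto simp: y_def)
    have y_eq: "y = (x / (1 + x'))\<^sup>2"
    proof -
      have "x\<^sup>2 = (1 - x') * (1 + x')"
        using x'(3) by (simp add: algebra_simps power2_eq_square)
      then show ?thesis
        using x' by (simp add: y_def power_divide) (simp add: power2_eq_square)
    qed
    have 1: "1 + y = 2 / (1 + x')"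
      using x' by (simp add: y_def field_simps)
    have "2 * sqrt y / (1 + y) = x"
      unfolding 1 using x x' by (simp add: y_eq)
    then have K: "elliptic_K x = (1 + y) * elliptic_K y"
      using elliptic_K_landen[OF y] by simp
    have "1 - y\<^sup>2 = 4 * x' / (1 + x')\<^sup>2"
      using x' by (simp add: y_def power_divide field_simps) (simp add: algebra_simps power2_eq_square)
    then have "sqrt (1 - y\<^sup>2) = 2 * sqrt x' / (1 + x')"
      using x' by (simp add: real_sqrt_divide real_sqrt_mult)
    then have K': "elliptic_K (sqrt (1 - y\<^sup>2)) = (1 + x') * elliptic_K x'"
      using elliptic_K_landen[OF x'(1,2)] by simp
    have "0 < elliptic_K y" using K_ge[of y] y pi_half_gt_zero by linarith
    then have "f y = 2 * f x"
      unfolding f_def x'_def[symmetric] K K' 1 using x' by (simp add: field_simps)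
    \<comment> \<open>Origin of the constant 4: with C in its place the claim reads C (1 + x')^2
      \<le> C^2, which holds for C = 4 since 1 + x' < 2.\<close>
    moreover have "ln (4 / y) \<le> 2 * ln (4 / x)"
    proof -
      have "4 / y = (2 * (1 + x') / x)\<^sup>2"
        using x x' by (simp add: y_eq power_divide power_mult_distrib del: distrib_left_numeral)
      also have "\<dots> \<le> (4 / x)\<^sup>2"
        using x x' by (intro power_mono divide_right_mono) auto
      finally have "ln (4 / y) \<le> ln ((4 / x)\<^sup>2)"
        using y x by (subst ln_le_cancel_iff) auto
      also have "\<dots> = 2 * ln (4 / x)"
        using x by (subst ln_realpow) auto
      finally show ?thesis .
    qed
    ultimately have "g y \<le> 2 * g x" by (simp add: g_def)
    with y show ?thesis by blast
  qed
  have iterate: "\<exists>y. 0 < y \<and> y < 1 \<and> g y \<le> 2 ^ j * g \<kappa>" for j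
  proof (induction j)
    case 0
    show ?case using assms by (intro exI[of _ \<kappa>]) auto
  next
    case (Suc j)
    then obtain y where y: "0 < y" "y < 1" "g y \<le> 2 ^ j * g \<kappa>" by blast
    from step[OF y(1,2)] obtain z where z: "0 < z" "z < 1" "g z \<le> 2 * g y" by blast
    with y(3) have "g z \<le> 2 ^ Suc j * g \<kappa>" by simp
    with z show ?case by blast
  qed
  have "0 \<le> g \<kappa>"
  proof (rule ccontr)
    assume "\<not> 0 \<le> g \<kappa>"
    then have neg: "0 < - g \<kappa>" by simp
    obtain j where "pi / (- g \<kappa>) < 2 ^ j"
      using real_arch_pow[of 2 "pi / (- g \<kappa>)"] by auto
    then have "2 ^ j * g \<kappa> < - pi"
      using neg by (simp add: field_simps)
    moreover obtain y where "0 < y" "y < 1" "g y \<le> 2 ^ j * g \<kappa>"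
      using iterate by blast
    ultimately show False using lower[of y] by linarith
  qed
  then show ?thesis by (simp add: g_def f_def)
qed

section \<open>Zolotarev rational functions\<close>

text \<open>Powers belonging to distinct roots are coprime: the product of those already treated
  does not vanish at the new root, so the whole order there remains in the cofactor.\<close>

lemma prod_linear_powers_dvd:
  fixes x :: "'i \<Rightarrow> 'a::idom"
  assumes "finite I" "inj_on x I" "\<And>i. i \<in> I \<Longrightarrow> [:- x i, 1:] ^ e i dvd f"
  shows "(\<Prod>i\<in>I. [:- x i, 1:] ^ e i) dvd f"
  using assms
proof (induction I rule: finite_induct)
  case (insert i I)
  define D where "D = (\<Prod>j\<in>I. [:- x j, 1:] ^ e j)"
  have "D dvd f"
    unfolding D_def using insert.prems by (intro insert.IH) auto
  then obtain t where t: "f = D * t" by blast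
  have "poly D (x i) = (\<Prod>j\<in>I. (x i - x j) ^ e j)"
    by (simp add: D_def poly_prod)
  also have "\<dots> \<noteq> 0"
    using insert by (auto simp: inj_on_def)
  finally have D_x: "poly D (x i) \<noteq> 0" .
  then have D: "order (x i) D = 0" by (rule order_0I)
  have "[:- x i, 1:] ^ e i dvd t"
  proof (cases "f = 0")
    case True
    with D_x t have "t = 0" by auto
    then show ?thesis by simp
  next
    case False
    then have "order (x i) f = order (x i) t"
      unfolding t by (subst order_mult) (simp_all add: D)
    moreover have "e i \<le> order (x i) f"
      using insert.prems(2)[of i] False by (simp add: order_divides)
    ultimately show ?thesis by (simp add: order_divides)
  qed
  then show ?case
    unfolding t using insert.hyps by (simp add: D_def[symmetric] mult.commute mult_dvd_mono)
qed simp

text \<open>The last step of both root counts: once the known roots exhaust the degree, a single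
  coefficient is left to identify.\<close>

lemma monic_dvd_imp_eq_smult:
  fixes D f :: "'a::field poly"
  assumes "D dvd f" "lead_coeff D = 1" "degree f \<le> degree D"
  shows "f = smult (coeff f (degree D)) D"
proof -
  obtain t where t: "f = D * t" using assms by blast
  show ?thesis
  proof (cases "f = 0")
    case False
    with t have "degree f = degree D + degree t" "t \<noteq> 0"
      by (auto simp: degree_mult_eq)
    with assms have "degree t = 0" by simp
    then obtain c where "t = [:c:]" using degree_0_id by metis
    then show ?thesis using t assms by simp
  qed simp
qed

lemma square_dvd_if_double_root:
  fixes f :: "'a::field poly"
  assumes "poly f x = 0" "poly (pderiv f) x = 0"
  shows "[:- x, 1:] ^ 2 dvd f"
proof -
  obtain g where g: "f = [:- x, 1:] * g"
    using assms(1) unfolding poly_eq_0_iff_dvd by blast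
  have "poly g x = 0"
    using assms(2) unfolding g pderiv_mult by (simp add: pderiv_pCons)
  then show ?thesis
    unfolding g power2_eq_square by (intro mult_dvd_mono) (auto simp: poly_eq_0_iff_dvd)
qed

lemma degree_lead_coeff_prod_linear:
  fixes x :: "'i \<Rightarrow> 'a::field"
  shows "degree (\<Prod>i\<in>I. [:- x i, 1:] ^ e i) = (\<Sum>i\<in>I. e i)"
    and "lead_coeff (\<Prod>i\<in>I. [:- x i, 1:] ^ e i) = 1"
proof -
  show 1: "degree (\<Prod>i\<in>I. [:- x i, 1:] ^ e i) = (\<Sum>i\<in>I. e i)"
    by (subst degree_prod_eq_sum_degree) (auto simp: degree_power_eq)
  show "lead_coeff (\<Prod>i\<in>I. [:- x i, 1:] ^ e i) = 1"
    by (simp add: lead_coeff_prod lead_coeff_power)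
qed

section \<open>Nodes, extremal points and equioscillation\<close>

locale zolotarev_nodes = elliptic_modulus +
  fixes k :: nat
  assumes \<kappa>_pos: "0 < \<kappa>" and k_pos: "0 < k"
begin

text \<open>Counted from 0, \<open>b j\<close> is the odd multiple (2j+1) h/2 and \<open>a j\<close>
  a zero of \<open>R\<close>; the even multiples i h give the points \<open>x i\<close>, at which
  |R| = M. The roots of \<open>p\<close> and \<open>pt\<close> are opposite, so \<open>R\<close>
  takes reciprocal values at opposite points.\<close>

definition "\<kappa>' = sqrt (1 - \<kappa>\<^sup>2)"
definition "h = KK / real k"
definition "b j = (2 * real j + 1) / (2 * real k) * KK"
definition "a j = dn (b j)"
definition "x i = dn (real i * h)"
definition "R t = (\<Prod>j<k. (t - a j) / (t + a j))"
definition "p = (\<Prod>j<k. [:- a j, 1:])"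
definition "pt = (\<Prod>j<k. [:a j, 1:])"
definition "M = R 1"

lemma \<kappa>': "0 < \<kappa>'" "\<kappa>' < 1" "\<kappa>'\<^sup>2 = 1 - \<kappa>\<^sup>2"
  using square_less_1 \<kappa>_pos by (auto simp: \<kappa>'_def real_sqrt_lt_1_iff)

lemma dn_KK: "dn KK = \<kappa>'"
  by (simp add: dn_eq \<kappa>'_def)

lemma h_pos: "0 < h"
  using KK_pos k_pos by (simp add: h_def)

lemma k_h: "real k * h = KK"
  using k_pos by (simp add: h_def)

lemma b_bounds: "j < k \<Longrightarrow> 0 < b j" "j < k \<Longrightarrow> b j < KK"
proof -
  assume "j < k"
  then have "2 * real j + 1 < 2 * real k" by linarith
  then have "(2 * real j + 1) / (2 * real k) < 1" using k_pos by simp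
  then have "(2 * real j + 1) / (2 * real k) * KK < 1 * KK"
    using KK_pos by (intro mult_strict_right_mono) auto
  then show "b j < KK" by (simp add: b_def)
  show "0 < b j" using KK_pos k_pos by (simp add: b_def)
qed

lemma b_Suc: "b (Suc j) = b j + h" and b_0: "b 0 = h / 2" and b_last: "0 < k \<Longrightarrow> b (k - 1) = KK - h / 2"
  using k_pos by (auto simp: b_def h_def field_simps of_nat_diff)

lemma a_bounds: "j < k \<Longrightarrow> \<kappa>' < a j" "j < k \<Longrightarrow> a j < 1"
  using dn_anti[OF \<kappa>_pos, of 0 "b j"] dn_anti[OF \<kappa>_pos, of "b j" KK] b_bounds[of j] dn_KK KK_pos
  by (auto simp: a_def)

lemma a_pos: "j < k \<Longrightarrow> 0 < a j"
  using a_bounds(1)[of j] \<kappa>' by linarith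

lemma x_0: "x 0 = 1" and x_k: "x k = \<kappa>'"
  by (auto simp: x_def k_h dn_KK)

lemma x_anti: "i < j \<Longrightarrow> j \<le> k \<Longrightarrow> x j < x i"
proof -
  assume "i < j" "j \<le> k"
  then have "real i * h < real j * h" "real j * h \<le> real k * h"
    using h_pos by auto
  then show ?thesis
    unfolding x_def using h_pos k_h by (intro dn_anti \<kappa>_pos) auto
qed

lemma x_bounds: "0 < i \<Longrightarrow> i < k \<Longrightarrow> \<kappa>' < x i" "0 < i \<Longrightarrow> i < k \<Longrightarrow> x i < 1"
  using x_anti[of 0 i] x_anti[of i k] by (auto simp: x_0 x_k)

lemma inj_x: "inj_on x {..k}"
  using x_anti by (intro inj_onI) (metis atMost_iff linorder_neqE_nat order_less_irrefl)

text \<open>\<open>\<sigma>_mult\<close> is read with a = b j; its numerator is reversed, which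
  costs one sign per factor. The result is a product over a grid that can be translated.\<close>

lemma R_dn: "R (dn u) = (- 1) ^ k * ((\<Prod>j<k. \<sigma> (u + b j)) * (\<Prod>j<k. \<sigma> (u - b j)))"
proof -
  have "(dn u - a j) / (dn u + a j) = - 1 * (\<sigma> (u + b j) * \<sigma> (u - b j))" for j
    unfolding \<sigma>_mult a_def by (simp add: minus_divide_left add.commute)
  then have "R (dn u) = (\<Prod>j<k. - 1 * (\<sigma> (u + b j) * \<sigma> (u - b j)))"
    by (simp only: R_def)
  also have "\<dots> = (- 1) ^ k * ((\<Prod>j<k. \<sigma> (u + b j)) * (\<Prod>j<k. \<sigma> (u - b j)))"
    by (simp only: prod.distrib prod_constant card_lessThan)
  finally show ?thesis .
qed

text \<open>Modulo $2K$ the points $\pm b_j$ form an equally spaced grid of step $h$, which a shift by $h$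
  permutes; the sign is that of the single factor that crosses the period of \<open>\<sigma>\<close>.\<close>

lemma R_dn_plus: "R (dn (u + h)) = - R (dn u)"
proof -
  obtain l where l: "k = Suc l" using k_pos gr0_conv_Suc by blast
  then have kl: "{..<k} = {..<Suc l}" by simp
  have 1: "u + h + b j = u + b (Suc j)" "u + h - b (Suc j) = u - b j" for j
    by (simp_all add: b_Suc)
  have 2: "u + h - b 0 = u + b 0" by (simp add: b_0)
  have "u + h + b l = u - b l + 2 * KK"
    using b_last k_pos by (simp add: l)
  then have 3: "\<sigma> (u + h + b l) = - \<sigma> (u - b l)"
    by (simp only: \<sigma>_plus)
  have A: "(\<Prod>j<k. \<sigma> (u + h + b j)) = (\<Prod>j<l. \<sigma> (u + b (Suc j))) * - \<sigma> (u - b l)"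
    unfolding kl prod.lessThan_Suc 3 by (simp only: 1)
  have B: "(\<Prod>j<k. \<sigma> (u + h - b j)) = \<sigma> (u + b 0) * (\<Prod>j<l. \<sigma> (u - b j))"
    unfolding kl prod.lessThan_Suc_shift 2 by (simp only: 1)
  have C: "(\<Prod>j<k. \<sigma> (u + b j)) = \<sigma> (u + b 0) * (\<Prod>j<l. \<sigma> (u + b (Suc j)))"
    unfolding kl prod.lessThan_Suc_shift ..
  have D: "(\<Prod>j<k. \<sigma> (u - b j)) = (\<Prod>j<l. \<sigma> (u - b j)) * \<sigma> (u - b l)"
    unfolding kl prod.lessThan_Suc ..
  show ?thesis
    unfolding R_dn A B C D by simp
qed

lemma R_x: "R (x i) = (- 1) ^ i * M"
proof (induction i)
  case (Suc i)
  have "x (Suc i) = dn (real i * h + h)" by (simp add: x_def algebra_simps)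
  then show ?case using Suc R_dn_plus[of "real i * h"] by (simp add: x_def)
qed (simp add: x_0 M_def)

lemma M_bounds: "0 < M" "M < 1"
proof -
  have 1: "0 < (1 - a j) / (1 + a j)" "(1 - a j) / (1 + a j) < 1" if "j < k" for j
    using a_pos[OF that] a_bounds[OF that] by auto
  show "0 < M" unfolding M_def R_def using 1 by (intro prod_pos) auto
  show "M < 1" unfolding M_def R_def
    using prod_mono_strict[of 0 "{..<k}" "\<lambda>j. (1 - a j) / (1 + a j)" "\<lambda>_. 1"] 1 k_pos
    by (auto simp: less_imp_le)
qed

text \<open>The numerator of the derivative of $R$ is even; $V$ is this numerator as a polynomial in $t^2$.\<close>

definition "V = (\<Sum>j<k. smult (2 * a j) (\<Prod>i\<in>{..<k} - {j}. [:- (a i)\<^sup>2, 1:]))"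

lemma poly_p: "poly p t = (\<Prod>j<k. t - a j)" and poly_pt: "poly pt t = (\<Prod>j<k. t + a j)"
  by (simp_all add: p_def pt_def poly_prod add.commute)

lemma R_eq: "R t = poly p t / poly pt t"
  by (simp add: R_def poly_p poly_pt prod_dividef)

text \<open>All poles of \<open>R\<close> lie below -\<kappa>'. The condition on t covers both
  ranges of integration, [x 1, 1] and [-\<kappa>', \<kappa>'].\<close>

lemma poly_pt_pos:
  assumes "- \<kappa>' \<le> t"
  shows "0 < poly pt t"
  unfolding poly_pt
proof (rule prod_pos)
  fix j assume "j \<in> {..<k}"
  then show "0 < t + a j" using a_bounds(1)[of j] assms by simp
qed

lemma R_deriv:
  assumes "- \<kappa>' \<le> t"
  shows "(R has_real_derivative poly V (t\<^sup>2) / (poly pt t)\<^sup>2) (at t)"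
proof -
  have ne: "t + a j \<noteq> 0" if "j < k" for j
    using a_bounds[OF that] assms by linarith
  have "((\<lambda>t. (t - a j) / (t + a j)) has_real_derivative 2 * a j / (t + a j)\<^sup>2) (at t)" if "j < k" for j
    using ne[OF that] by (auto intro!: derivative_eq_intros simp: power2_eq_square)
  then have "(R has_real_derivative (\<Sum>j<k. 2 * a j / (t + a j)\<^sup>2 * (\<Prod>i\<in>{..<k} - {j}. (t - a i) / (t + a i)))) (at t)"
    unfolding R_def by (intro has_field_derivative_prod) auto
  moreover have "2 * a j / (t + a j)\<^sup>2 * (\<Prod>i\<in>{..<k} - {j}. (t - a i) / (t + a i))
    = 2 * a j * (\<Prod>i\<in>{..<k} - {j}. t\<^sup>2 - (a i)\<^sup>2) / (poly pt t)\<^sup>2" if j: "j < k" for j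
  proof -
    have pt: "poly pt t = (t + a j) * (\<Prod>i\<in>{..<k} - {j}. t + a i)"
      unfolding poly_pt using j by (subst prod.remove[of _ j]) auto
    have eq: "(\<Prod>i\<in>{..<k} - {j}. (t - a i) / (t + a i)) * (\<Prod>i\<in>{..<k} - {j}. t + a i)\<^sup>2
        = (\<Prod>i\<in>{..<k} - {j}. t\<^sup>2 - (a i)\<^sup>2)"
      unfolding power2_eq_square prod.distrib[symmetric] using ne
      by (intro prod.cong) (auto simp: field_simps)
    have "(\<Prod>i\<in>{..<k} - {j}. t + a i) \<noteq> 0" using ne by simp
    then show ?thesis
      unfolding pt power_mult_distrib eq[symmetric] by simp
  qed
  ultimately show ?thesis
    by (simp add: V_def poly_sum poly_prod sum_divide_distrib)
qed

lemma degree_V: "degree V \<le> k - 1" and coeff_V: "0 < coeff V (k - 1)"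
proof -
  let ?P = "\<lambda>j. \<Prod>i\<in>{..<k} - {j}. [:- (a i)\<^sup>2, 1:] ^ 1"
  have card: "card ({..<k} - {j}) = k - 1" if "j < k" for j
    using that by simp
  have deg: "degree (?P j) = k - 1" "coeff (?P j) (k - 1) = 1" if "j < k" for j
    using degree_lead_coeff_prod_linear[of "\<lambda>i. (a i)\<^sup>2" "\<lambda>_. 1" "{..<k} - {j}"] card[OF that]
    by (simp_all del: power_one_right)
  show "degree V \<le> k - 1" unfolding V_def
    using deg by (intro degree_sum_le) (auto intro: order_trans[OF degree_smult_le])
  have "coeff V (k - 1) = (\<Sum>j<k. 2 * a j)"
    unfolding V_def coeff_sum using deg by (intro sum.cong) simp_all
  also have "\<dots> > 0" using a_pos k_pos by (intro sum_pos) auto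
  finally show "0 < coeff V (k - 1)" .
qed

definition "v = coeff V (k - 1)"

text \<open>The derivative of R (dn u) vanishes at u = 0, where sn does, and changes sign under a
  shift by h as the function itself does; so it vanishes at every i h. For 0 < i < k the inner
  derivative of dn is nonzero there, hence the zero belongs to \<open>V\<close>.\<close>

lemma V_x:
  assumes "0 < i" "i < k"
  shows "poly V ((x i)\<^sup>2) = 0"
proof -
  define g' where "g' = (\<lambda>u. poly V ((dn u)\<^sup>2) / (poly pt (dn u))\<^sup>2 * - (\<kappa>\<^sup>2 * sn u * cn u))"
  have g': "((\<lambda>u. R (dn u)) has_real_derivative g' u) (at u)" for u
    unfolding g'_def using dn_pos[of u] \<kappa>'
    by (intro DERIV_chain2[OF R_deriv dn_deriv]) linarith
  have 0: "g' 0 = 0" by (simp add: g'_def)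
  have "g' (u + h) = - g' u" for u
  proof -
    have "((\<lambda>u. R (dn (u + h))) has_real_derivative g' (u + h) * 1) (at u)"
      by (rule DERIV_chain2[OF g']) (auto intro!: derivative_eq_intros)
    moreover have "((\<lambda>u. - R (dn u)) has_real_derivative - g' u) (at u)"
      by (intro DERIV_minus g')
    ultimately show ?thesis
      unfolding R_dn_plus using DERIV_unique by fastforce
  qed
  then have "g' (real i * h) = 0" for i
    by (induction i) (simp_all add: 0 distrib_right add.commute[of 1])
  moreover have "sn (real i * h) \<noteq> 0" "cn (real i * h) \<noteq> 0"
  proof -
    have "0 < real i * h" "real i * h < KK"
      using assms h_pos k_h by (auto simp flip: k_h)
    then have "0 < am (real i * h)" "am (real i * h) < pi / 2"
      using am_strict_mono[of 0 "real i * h"] am_strict_mono[of "real i * h" KK] by (auto simp: am_KK)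
    then show "sn (real i * h) \<noteq> 0" "cn (real i * h) \<noteq> 0"
      unfolding sn_def cn_def using sin_gt_zero[of "am (real i * h)"] cos_gt_zero[of "am (real i * h)"] by auto
  qed
  moreover have "poly pt (x i) \<noteq> 0"
    using poly_pt_pos[of "x i"] x_bounds[OF assms] \<kappa>' by auto
  ultimately show ?thesis
    using \<kappa>_pos by (auto simp: g'_def x_def)
qed

text \<open>\<open>V_x\<close> supplies k - 1 distinct roots, as many as the degree allows; so the
  interior points \<open>x i\<close> are the only critical points of \<open>R\<close> to the right
  of -\<kappa>'.\<close>

lemma poly_V: "poly V t = v * (\<Prod>i\<in>{1..<k}. t - (x i)\<^sup>2)"
proof -
  let ?D = "\<Prod>i\<in>{1..<k}. [:- (x i)\<^sup>2, 1:] ^ 1"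
  have "?D dvd V"
  proof (rule prod_linear_powers_dvd)
    have "0 < x i" for i unfolding x_def by (rule dn_pos)
    moreover have "inj_on x {1..<k}" using inj_x by (rule inj_on_subset) auto
    ultimately show "inj_on (\<lambda>i. (x i)\<^sup>2) {1..<k}"
      by (intro inj_onI) (simp add: power2_eq_iff_nonneg less_imp_le inj_on_eq_iff)
  qed (use V_x in \<open>auto simp: poly_eq_0_iff_dvd[symmetric]\<close>)
  moreover note * = degree_lead_coeff_prod_linear[of "\<lambda>i. (x i)\<^sup>2" "\<lambda>_. 1" "{1..<k}"]
  moreover have "degree V \<le> degree ?D" using degree_V by (simp only: *) simp
  ultimately have "V = smult (coeff V (degree ?D)) ?D"
    by (intro monic_dvd_imp_eq_smult) auto
  moreover have "coeff V (degree ?D) = v" by (simp only: * v_def) simp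
  ultimately have "V = smult v ?D" by metis
  then have "poly V t = poly (smult v ?D) t" by (rule arg_cong)
  then show ?thesis by (simp add: poly_prod)
qed


definition "q t = (\<Prod>i\<in>{1..<k}. t - x i)"

lemma M_sq: "0 < M\<^sup>2" "M\<^sup>2 < 1"
  using M_bounds by (auto simp: power_less_one_iff)

lemma degree_p: "degree p = k" "coeff p k = 1" and degree_pt: "degree pt = k" "coeff pt k = 1"
  using degree_lead_coeff_prod_linear[of a "\<lambda>_. 1" "{..<k}"]
    degree_lead_coeff_prod_linear[of "\<lambda>j. - a j" "\<lambda>_. 1" "{..<k}"]
  by (simp_all add: p_def pt_def)

text \<open>Both sides are polynomials of degree $2k$ with simple roots at $1$, $\kappa'$ and double roots at the
  interior extremal points $x_i$.\<close>

lemma equioscillation: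
  "M\<^sup>2 * (poly pt t)\<^sup>2 - (poly p t)\<^sup>2 = (1 - M\<^sup>2) * ((1 - t) * (t - \<kappa>') * (q t)\<^sup>2)"
proof -
  define Q where "Q = smult (M\<^sup>2) (pt\<^sup>2) - p\<^sup>2"
  define e :: "nat \<Rightarrow> nat" where "e = (\<lambda>i. if i = 0 \<or> i = k then 1 else 2)"
  define D where "D = (\<Prod>i\<in>{..k}. [:- x i, 1:] ^ e i)"
  have Q_eq: "poly Q t = (M\<^sup>2 - (R t)\<^sup>2) * (poly pt t)\<^sup>2" if "- \<kappa>' \<le> t" for t
    using poly_pt_pos[OF that] by (simp add: Q_def R_eq power_divide field_simps)
  have x_ge: "- \<kappa>' \<le> x i" for i
    using dn_pos[of "real i * h"] \<kappa>' by (simp add: x_def)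
  have "(R (x i))\<^sup>2 = M\<^sup>2" for i
    by (simp add: R_x power_mult_distrib power_even_eq[symmetric] flip: power_mult)
  then have Q_x: "poly Q (x i) = 0" for i
    using Q_eq[OF x_ge, of i] by simp
  have "[:- x i, 1:] ^ e i dvd Q" if "i \<le> k" for i
  proof (cases "i = 0 \<or> i = k")
    case True
    then show ?thesis using Q_x[of i] by (simp add: e_def poly_eq_0_iff_dvd)
  next
    case False
    then have i: "0 < i" "i < k" using that by auto
    have "(R has_real_derivative 0) (at (x i))"
      using R_deriv[OF x_ge, of i] V_x[OF i] by simp
    then have "((\<lambda>t. (M\<^sup>2 - (R t)\<^sup>2) * (poly pt t)\<^sup>2) has_real_derivative
        (0 - 2 * R (x i) * 0) * (poly pt (x i))\<^sup>2 +
        (2 * poly pt (x i) * poly (pderiv pt) (x i)) * (M\<^sup>2 - (R (x i))\<^sup>2)) (at (x i))"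
      by (intro DERIV_mult DERIV_diff DERIV_const) (auto intro!: derivative_eq_intros poly_DERIV)
    then have 0: "((\<lambda>t. (M\<^sup>2 - (R t)\<^sup>2) * (poly pt t)\<^sup>2) has_real_derivative 0) (at (x i))"
      by (simp add: \<open>(R (x i))\<^sup>2 = M\<^sup>2\<close>)
    \<comment> \<open>The product form of \<open>Q\<close> is available only from -\<kappa>' on;
      this contains a neighbourhood of \<open>x i\<close>, which is enough for the
      derivative.\<close>
    have ev: "\<forall>\<^sub>F t in nhds (x i). (M\<^sup>2 - (R t)\<^sup>2) * (poly pt t)\<^sup>2 = poly Q t"
    proof -
      have "x i \<in> {- \<kappa>'<..}" using x_bounds[OF i] \<kappa>' by simp
      then have "\<forall>\<^sub>F t in nhds (x i). t \<in> {- \<kappa>'<..}"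
        by (intro eventually_nhds_in_open) auto
      then show ?thesis by eventually_elim (simp add: Q_eq)
    qed
    have "(poly Q has_real_derivative 0) (at (x i))"
      using 0 unfolding DERIV_cong_ev[OF refl ev refl] .
    then have "poly (pderiv Q) (x i) = 0"
      by (rule DERIV_unique[OF poly_DERIV])
    with Q_x[of i] have "[:- x i, 1:] ^ 2 dvd Q" by (intro square_dvd_if_double_root)
    then show ?thesis using False by (simp add: e_def)
  qed
  then have D_dvd: "D dvd Q"
    unfolding D_def using inj_x by (intro prod_linear_powers_dvd) auto
  have split: "{..k} = insert 0 (insert k {1..<k})" "0 \<notin> insert k {1..<k}" "k \<notin> {1..<k}"
    using k_pos by auto
  have "(\<Sum>i\<in>{..k}. e i) = e 0 + e k + (\<Sum>i\<in>{1..<k}. e i)"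
    using split by simp
  also have "(\<Sum>i\<in>{1..<k}. e i) = (\<Sum>i\<in>{1..<k}. 2)"
    by (intro sum.cong) (auto simp: e_def)
  finally have "(\<Sum>i\<in>{..k}. e i) = 2 * k"
    using k_pos by (simp add: e_def)
  then have deg_D: "degree D = 2 * k" "lead_coeff D = 1"
    unfolding D_def by (simp only: degree_lead_coeff_prod_linear(1)) (rule degree_lead_coeff_prod_linear(2))
  have deg_sq: "degree (pt\<^sup>2) = 2 * k" "degree (p\<^sup>2) = 2 * k"
    using degree_power_eq[of pt 2] degree_power_eq[of p 2] degree_p degree_pt k_pos
    by (cases "pt = 0"; cases "p = 0"; simp)+
  then have deg_Q: "degree Q \<le> degree D"
    unfolding Q_def deg_D by (intro degree_diff_le) (auto intro: order_trans[OF degree_smult_le])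
  from monic_dvd_imp_eq_smult[OF D_dvd deg_D(2) deg_Q] have "Q = smult (coeff Q (2 * k)) D"
    unfolding deg_D .
  \<comment> \<open>\<open>p\<close> and \<open>pt\<close> are monic, so the two squares contribute
    -1 and M^2.\<close>
  moreover have "coeff Q (2 * k) = M\<^sup>2 - 1"
  proof -
    have "coeff (pt\<^sup>2) (2 * k) = 1" "coeff (p\<^sup>2) (2 * k) = 1"
      using lead_coeff_power[of pt 2] lead_coeff_power[of p 2] deg_sq degree_p degree_pt by simp_all
    then show ?thesis by (simp add: Q_def)
  qed
  ultimately have Q_D: "poly Q t = (M\<^sup>2 - 1) * poly D t" by (metis poly_smult)
  have "poly D t = (\<Prod>i\<in>{..k}. (t - x i) ^ e i)"
    by (simp add: D_def poly_prod)
  also have "\<dots> = (t - 1) * ((t - \<kappa>') * (\<Prod>i\<in>{1..<k}. (t - x i) ^ e i))"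
    using split by (simp add: x_0 x_k e_def)
  also have "(\<Prod>i\<in>{1..<k}. (t - x i) ^ e i) = (\<Prod>i\<in>{1..<k}. (t - x i) ^ 2)"
    by (intro prod.cong) (auto simp: e_def)
  also have "\<dots> = (q t)\<^sup>2" by (simp add: q_def prod_power_distrib)
  finally have "poly D t = (t - 1) * ((t - \<kappa>') * (q t)\<^sup>2)" .
  with Q_D have "poly Q t = (M\<^sup>2 - 1) * ((t - 1) * ((t - \<kappa>') * (q t)\<^sup>2))" by simp
  also have "\<dots> = (1 - M\<^sup>2) * ((1 - t) * (t - \<kappa>') * (q t)\<^sup>2)"
    by (simp add: algebra_simps)
  finally show ?thesis by (simp add: Q_def)
qed

lemma R_sq: "- \<kappa>' \<le> t \<Longrightarrow>
    M\<^sup>2 - (R t)\<^sup>2 = (1 - M\<^sup>2) * ((1 - t) * (t - \<kappa>') * (q t)\<^sup>2) / (poly pt t)\<^sup>2"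
  using poly_pt_pos[of t] equioscillation[of t, symmetric] by (simp add: R_eq power_divide field_simps)

lemma poly_uminus: "poly pt (- t) = (- 1) ^ k * poly p t" "poly p (- t) = (- 1) ^ k * poly pt t"
proof -
  have "(\<Prod>j<k. - t + a j) = (\<Prod>j<k. - 1 * (t - a j))" "(\<Prod>j<k. - t - a j) = (\<Prod>j<k. - 1 * (t + a j))"
    by (auto intro: prod.cong)
  then show "poly pt (- t) = (- 1) ^ k * poly p t" "poly p (- t) = (- 1) ^ k * poly pt t"
    unfolding poly_p poly_pt prod.distrib by simp_all
qed

text \<open>This is \<open>equioscillation\<close> at -t, where \<open>p\<close> and
  \<open>pt\<close> change places up to a common sign. The zeros of the second factor thus lie at
  the mirrored extremal points.\<close>

lemma R_sq': "- \<kappa>' \<le> t \<Longrightarrow>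
    1 - M\<^sup>2 * (R t)\<^sup>2 = (1 - M\<^sup>2) * ((1 + t) * (t + \<kappa>') * (q (- t))\<^sup>2) / (poly pt t)\<^sup>2"
proof -
  assume "- \<kappa>' \<le> t"
  then have "0 < poly pt t" by (rule poly_pt_pos)
  moreover have "M\<^sup>2 * (poly p t)\<^sup>2 - (poly pt t)\<^sup>2 = (1 - M\<^sup>2) * ((1 + t) * (- t - \<kappa>') * (q (- t))\<^sup>2)"
    using equioscillation[of "- t"] unfolding poly_uminus
    by (simp add: power_mult_distrib power_even_eq[symmetric] flip: power_mult)
  then have "(poly pt t)\<^sup>2 - M\<^sup>2 * (poly p t)\<^sup>2 = (1 - M\<^sup>2) * ((1 + t) * (t + \<kappa>') * (q (- t))\<^sup>2)"
    by (simp add: algebra_simps)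
  ultimately show ?thesis
    unfolding R_eq power_divide by (simp add: field_simps)
qed

text \<open>On [\<kappa>', 1] every factor on the right of \<open>R_sq\<close> is
  nonnegative.\<close>

lemma abs_R_le:
  assumes "\<kappa>' \<le> t" "t \<le> 1"
  shows "\<bar>R t\<bar> \<le> M"
proof -
  have "0 \<le> (1 - M\<^sup>2) * ((1 - t) * (t - \<kappa>') * (q t)\<^sup>2) / (poly pt t)\<^sup>2"
    using assms M_sq by (intro divide_nonneg_nonneg mult_nonneg_nonneg) auto
  then have "(R t)\<^sup>2 \<le> M\<^sup>2"
    using R_sq[of t] assms \<kappa>' by simp
  then show ?thesis using M_bounds by (simp add: abs_le_square_iff[symmetric])
qed

section \<open>The differential equation satisfied by R\<close>

definition "c = v / (1 - M\<^sup>2)"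
definition "R' t = poly V (t\<^sup>2) / (poly pt t)\<^sup>2"

lemma v_pos: "0 < v"
  using coeff_V by (simp add: v_def)

lemma c_pos: "0 < c"
  using v_pos M_sq by (simp add: c_def)

lemma V_q: "poly V (t\<^sup>2) = v * ((- 1) ^ (k - 1) * (q t * q (- t)))"
proof -
  have "(\<Prod>i\<in>{1..<k}. t\<^sup>2 - (x i)\<^sup>2) = (\<Prod>i\<in>{1..<k}. - 1 * ((t - x i) * (- t - x i)))"
    by (intro prod.cong) (auto simp: algebra_simps power2_eq_square)
  then show ?thesis
    unfolding poly_V q_def prod.distrib by simp
qed

text \<open>The product of \<open>R_sq\<close> and \<open>R_sq'\<close> contains q(t)^2 q(-t)^2, as
  does the square of R' by \<open>V_q\<close>; the linear factors remain on the other side and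
  \<open>c\<close> collects the constants. After t = dn u this is, for R / M, the equation of sn
  with modulus M^2 and argument scaled by c.\<close>

lemma R_ode:
  assumes "- \<kappa>' \<le> t"
  shows "(R' t)\<^sup>2 * ((1 - t\<^sup>2) * (t\<^sup>2 - \<kappa>'\<^sup>2)) = c\<^sup>2 * ((M\<^sup>2 - (R t)\<^sup>2) * (1 - M\<^sup>2 * (R t)\<^sup>2))"
proof -
  have "1 - M\<^sup>2 \<noteq> 0" using M_sq by simp
  define N where "N = 1 - M\<^sup>2"
  have v: "v = c * N" and "N \<noteq> 0" using \<open>1 - M\<^sup>2 \<noteq> 0\<close> by (simp_all add: c_def N_def)
  have sq: "((- 1) ^ (k - 1) :: real)\<^sup>2 = 1"
    by (simp flip: power_mult)
  have "(R' t)\<^sup>2 = c\<^sup>2 * N\<^sup>2 * ((q t)\<^sup>2 * (q (- t))\<^sup>2) / ((poly pt t)\<^sup>2)\<^sup>2"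
    unfolding R'_def V_q v power_divide power_mult_distrib sq by simp
  moreover have "(1 - t\<^sup>2) * (t\<^sup>2 - \<kappa>'\<^sup>2) = ((1 - t) * (t - \<kappa>')) * ((1 + t) * (t + \<kappa>'))"
    by (simp add: algebra_simps power2_eq_square)
  moreover have "(M\<^sup>2 - (R t)\<^sup>2) * (1 - M\<^sup>2 * (R t)\<^sup>2) = N\<^sup>2 * ((q t)\<^sup>2 * (q (- t))\<^sup>2) / ((poly pt t)\<^sup>2)\<^sup>2 *
      (((1 - t) * (t - \<kappa>')) * ((1 + t) * (t + \<kappa>')))"
    unfolding R_sq[OF assms] R_sq'[OF assms] N_def[symmetric] by (simp add: power2_eq_square)
  ultimately show ?thesis by simp
qed

end

text \<open>The elliptic integral in its algebraic variable, the form in which both integrations of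
  \<open>R_ode\<close> use it.\<close>

lemma (in elliptic_modulus) F_arcsin_deriv:
  assumes "(y has_real_derivative y') (at u)" "\<bar>y u\<bar> < 1"
  shows "((\<lambda>u. F (arcsin (y u))) has_real_derivative
    y' / (sqrt (1 - \<kappa>\<^sup>2 * (y u)\<^sup>2) * sqrt (1 - (y u)\<^sup>2))) (at u)"
proof -
  have y: "- 1 < y u" "y u < 1" using assms(2) by auto
  have "((\<lambda>u. arcsin (y u)) has_real_derivative inverse (sqrt (1 - (y u)\<^sup>2)) * y') (at u)"
    by (rule DERIV_chain2[OF DERIV_arcsin[OF y] assms(1)])
  from F_deriv_chain[OF this] show ?thesis
    using y by (simp add: field_simps)
qed

section \<open>The complete integrals belonging to the modulus M^2\<close>

context zolotarev_nodes
begin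

lemma R_has_derivative: "- \<kappa>' \<le> t \<Longrightarrow> (R has_real_derivative R' t) (at t)"
  unfolding R'_def by (rule R_deriv)

lemma M4: "0 < 1 - M ^ 4" "M ^ 4 < 1"
  using M_bounds by (auto simp: power_less_one_iff)

text \<open>For k = 1 there is no interior extremal point and \<open>x 1\<close> is the end
  \<kappa>' itself; for every k it bounds the rightmost monotone arc of \<open>R\<close>.\<close>

lemma x_1_ge: "\<kappa>' \<le> x 1"
  using x_anti[of 1 k] x_k k_pos by (cases "k = 1") auto

lemma x_le_x_1: "i \<in> {1..<k} \<Longrightarrow> x i \<le> x 1"
  using x_anti[of 1 i] by (cases "i = 1") auto

lemma R'_pos:
  assumes t: "x 1 < t"
  shows "0 < R' t"
proof -
  have "0 < t\<^sup>2 - (x i)\<^sup>2" if "i \<in> {1..<k}" for i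
  proof -
    have "0 < x i" unfolding x_def by (rule dn_pos)
    then have "(x i)\<^sup>2 < t\<^sup>2" using t x_le_x_1[OF that] by (intro power_strict_mono) auto
    then show ?thesis by simp
  qed
  then have "0 < poly V (t\<^sup>2)" unfolding poly_V using v_pos by (intro mult_pos_pos prod_pos) auto
  moreover have "0 < poly pt t" using t x_1_ge \<kappa>' by (intro poly_pt_pos) auto
  ultimately show ?thesis by (simp add: R'_def)
qed

lemma q_nonzero: "x 1 < t \<Longrightarrow> q t \<noteq> 0"
  using x_le_x_1 by (fastforce simp: q_def)

text \<open>On the arc t = dn u with u from 0 to h, \<open>R\<close> falls from M to -M. By the
  differential equation F (arcsin (R / M)) falls at the constant rate c, from K(M^2) to -K(M^2); so
  \<open>G\<close> is constant.\<close>

lemma elliptic_K_M: "2 * elliptic_K (M\<^sup>2) = c * h"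
proof -
  interpret m: elliptic_modulus "M\<^sup>2"
    using M_sq by unfold_locales auto
  define D where "D = (\<lambda>u. R' (dn u) * - (\<kappa>\<^sup>2 * sn u * cn u))"
  define G where "G = (\<lambda>u. m.F (arcsin (R (dn u) / M)) + c * u)"
  have dn_ge: "- \<kappa>' \<le> dn u" for u
    using dn_pos[of u] \<kappa>' by linarith
  have D: "((\<lambda>u. R (dn u)) has_real_derivative D u) (at u)" for u
    unfolding D_def by (intro DERIV_chain2[OF R_has_derivative dn_deriv] dn_ge)
  have D_sq: "(D u)\<^sup>2 = c\<^sup>2 * ((M\<^sup>2 - (R (dn u))\<^sup>2) * (1 - M\<^sup>2 * (R (dn u))\<^sup>2))" for u
  proof -
    have "(D u)\<^sup>2 = (R' (dn u))\<^sup>2 * ((\<kappa>\<^sup>2 * (sn u)\<^sup>2) * (\<kappa>\<^sup>2 * (cn u)\<^sup>2))"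
      by (simp add: D_def power_mult_distrib power2_eq_square)
    \<comment> \<open>With the next identity, the chain rule factor of dn becomes the quartic on the
      left of \<open>R_ode\<close>.\<close>
    also have "\<kappa>\<^sup>2 * (sn u)\<^sup>2 = 1 - (dn u)\<^sup>2" by (simp add: dn_sq)
    also have "\<kappa>\<^sup>2 * (cn u)\<^sup>2 = (dn u)\<^sup>2 - \<kappa>'\<^sup>2" by (simp add: dn_sq cn_sq \<kappa>' algebra_simps)
    finally show ?thesis unfolding R_ode[OF dn_ge] .
  qed
  have "KK * 1 \<le> KK * real k" using KK_pos k_pos by (intro mult_left_mono) auto
  then have "h \<le> KK" using k_pos by (simp add: h_def divide_le_eq)
  have dn_range: "x 1 < dn u" "dn u < 1" if "0 < u" "u < h" for u
    using dn_anti[OF \<kappa>_pos, of 0 u] dn_anti[OF \<kappa>_pos, of u h] that \<open>h \<le> KK\<close> by (auto simp: x_def)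
  have ends: "R (dn 0) = M" "R (dn h) = - M"
    using R_x[of 0] R_x[of 1] by (auto simp: x_def)
  have "G h = G 0"
  proof (rule DERIV_isconst_end[OF h_pos])
    have bound: "\<bar>R (dn u)\<bar> \<le> M" if u: "u \<in> {0..h}" for u
    proof -
      consider "u = 0" | "u = h" | "0 < u" "u < h"
        using u by fastforce
      then show ?thesis
      proof cases
        case 3
        then show ?thesis using dn_range[of u] x_1_ge by (intro abs_R_le) auto
      qed (use ends M_bounds in auto)
    qed
    have "- 1 \<le> R (dn u) / M \<and> R (dn u) / M \<le> 1" if "u \<in> {0..h}" for u
      using bound[OF that] M_bounds(1) by (auto simp: abs_le_iff divide_le_eq le_divide_eq)
    moreover have "continuous_on {0..h} (\<lambda>u. R (dn u))"
      using D by (meson DERIV_isCont continuous_at_imp_continuous_on)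
    ultimately have "continuous_on {0..h} (\<lambda>u. arcsin (R (dn u) / M))"
      using M_bounds by (intro continuous_on_arcsin continuous_on_divide continuous_on_const) auto
    from continuous_on_compose2[OF m.F_cont this subset_UNIV]
    show "continuous_on {0..h} G"
      unfolding G_def by (intro continuous_on_add continuous_on_mult continuous_on_const continuous_on_id)
  next
    fix u assume u: "0 < u" "u < h"
    define y where "y = R (dn u)"
    note d = dn_range[OF u]
    have p1: "0 < M\<^sup>2 - y\<^sup>2"
      unfolding R_sq[OF dn_ge] y_def using d x_1_ge M_sq q_nonzero[OF d(1)] poly_pt_pos[OF dn_ge, of u]
      by (intro divide_pos_pos mult_pos_pos) auto
    then have y: "\<bar>y\<bar> < M"
      using M_bounds power2_less_imp_less[of "\<bar>y\<bar>" M] by simp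
    have "M\<^sup>2 * y\<^sup>2 < 1 * 1"
      using p1 M_sq by (intro mult_strict_mono) auto
    then have p2: "0 < 1 - M\<^sup>2 * y\<^sup>2" by simp
    have "am 0 < am u" "am u < am KK"
      using u \<open>h \<le> KK\<close> by (intro am_strict_mono; simp)+
    then have "0 < sn u" "0 < cn u"
      unfolding sn_def cn_def by (auto intro!: sin_gt_zero cos_gt_zero simp: am_KK)
    \<comment> \<open>The sign selects the negative square root in \<open>D_sq\<close>.\<close>
    then have "D u < 0"
      using R'_pos[OF d(1)] \<kappa>_pos by (simp add: D_def)
    then have "- D u = sqrt ((D u)\<^sup>2)" by simp
    also have "\<dots> = c * (sqrt (M\<^sup>2 - y\<^sup>2) * sqrt (1 - M\<^sup>2 * y\<^sup>2))"
      unfolding D_sq y_def[symmetric] using c_pos by (simp add: real_sqrt_mult)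
    finally have Du: "D u = - (c * (sqrt (M\<^sup>2 - y\<^sup>2) * sqrt (1 - M\<^sup>2 * y\<^sup>2)))" by simp
    have "1 - (y / M)\<^sup>2 = (M\<^sup>2 - y\<^sup>2) / M\<^sup>2"
      using M_bounds by (simp add: power_divide diff_divide_distrib)
    then have s1: "sqrt (1 - (y / M)\<^sup>2) = sqrt (M\<^sup>2 - y\<^sup>2) / M"
      using M_bounds by (simp add: real_sqrt_divide)
    have s2: "1 - (M\<^sup>2)\<^sup>2 * (y / M)\<^sup>2 = 1 - M\<^sup>2 * y\<^sup>2"
      using M_bounds by (simp add: power2_eq_square)
    have "((\<lambda>u. m.F (arcsin (R (dn u) / M))) has_real_derivative
        D u / M / (sqrt (1 - (M\<^sup>2)\<^sup>2 * (y / M)\<^sup>2) * sqrt (1 - (y / M)\<^sup>2))) (at u)"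
      unfolding y_def using y M_bounds
      by (intro m.F_arcsin_deriv DERIV_cdivide D) (simp add: y_def)
    also have "D u / M / (sqrt (1 - (M\<^sup>2)\<^sup>2 * (y / M)\<^sup>2) * sqrt (1 - (y / M)\<^sup>2)) = - c"
      unfolding s1 s2 Du using p1 p2 M_bounds by simp
    finally have "(G has_real_derivative - c + c * 1) (at u)"
      unfolding G_def by (intro DERIV_add DERIV_cmult DERIV_ident)
    then show "(G has_real_derivative 0) (at u)" by simp
  qed
  then show ?thesis
    using M_bounds m.F_odd[of "pi / 2"] unfolding G_def ends
    by (simp add: elliptic_K_def)
qed


text \<open>Between -\<kappa>' and \<kappa>' all k factors of \<open>R\<close> and all k - 1 linear
  factors of \<open>V\<close> are negative, an odd number in total; so |R| decreases.\<close>

lemma R_R'_neg: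
  assumes "- \<kappa>' < t" "t < \<kappa>'"
  shows "R t * R' t < 0"
proof -
  obtain l where l: "k = Suc l" using k_pos gr0_conv_Suc by blast
  define P where "P = (\<Prod>j<k. (a j - t) / (t + a j))"
  define Q where "Q = (\<Prod>i\<in>{1..<k}. (x i)\<^sup>2 - t\<^sup>2)"
  have "0 < (a j - t) / (t + a j)" if "j < k" for j
    using a_bounds(1)[OF that] assms by (intro divide_pos_pos) auto
  then have P: "0 < P" unfolding P_def by (intro prod_pos) auto
  have "0 < (x i)\<^sup>2 - t\<^sup>2" if "i \<in> {1..<k}" for i
  proof -
    have "\<bar>t\<bar> < \<bar>x i\<bar>" using assms x_bounds(1)[of i] that \<kappa>' by auto
    then show ?thesis by (simp add: abs_less_iff power2_strict_mono)
  qed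
  then have Q: "0 < Q" unfolding Q_def by (intro prod_pos) auto
  have "R t = (\<Prod>j<k. - 1 * ((a j - t) / (t + a j)))"
    unfolding R_def by (intro prod.cong) (auto simp: minus_divide_left)
  then have R: "R t = (- 1) ^ k * P"
    by (simp only: P_def prod.distrib prod_constant card_lessThan)
  have "(\<Prod>i\<in>{1..<k}. t\<^sup>2 - (x i)\<^sup>2) = (\<Prod>i\<in>{1..<k}. - 1 * ((x i)\<^sup>2 - t\<^sup>2))"
    by (intro prod.cong) auto
  also have "\<dots> = (- 1) ^ l * Q"
    by (simp only: Q_def prod.distrib prod_constant card_atLeastLessThan) (simp add: l)
  finally have R': "R' t = v * ((- 1) ^ l * Q) / (poly pt t)\<^sup>2"
    by (simp add: R'_def poly_V)
  have "R t * R' t = - (P * v * Q / (poly pt t)\<^sup>2) * ((- 1) ^ l * (- 1) ^ l)"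
    unfolding R R' by (simp add: l)
  also have "((- 1) ^ l * (- 1) ^ l :: real) = 1"
    by (simp flip: power_mult_distrib)
  finally show ?thesis
    using P Q v_pos poly_pt_pos[of t] assms by (simp add: zero_less_divide_iff zero_less_mult_iff)
qed

lemma elliptic_K_M_complement: "elliptic_K (sqrt (1 - (M\<^sup>2)\<^sup>2)) = 2 * c * elliptic_K \<kappa>'"
proof -
  have M2: "(M\<^sup>2)\<^sup>2 = M ^ 4" by (simp flip: power_mult)
  define \<mu> where "\<mu> = sqrt (1 - M ^ 4)"
  have \<mu>: "\<mu>\<^sup>2 = 1 - M ^ 4" "0 < \<mu>" "\<mu> < 1"
    using M4 M_bounds by (auto simp: \<mu>_def real_sqrt_lt_1_iff)
  interpret m: elliptic_modulus \<mu>
    using \<mu> by unfold_locales auto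
  interpret k': elliptic_modulus \<kappa>'
    using \<kappa>' by unfold_locales auto
  define Y where "Y = (\<lambda>\<phi>. R (\<kappa>' * sin \<phi>))"
  define S where "S = (\<lambda>\<phi>. (1 - M\<^sup>2 * (Y \<phi>)\<^sup>2) / \<mu>\<^sup>2)"
  define G where "G = (\<lambda>\<phi>. m.F (arcsin (sqrt (S \<phi>))) - c * k'.F \<phi>)"
  have ge: "- \<kappa>' \<le> \<kappa>' * sin \<phi>" for \<phi>
    using \<kappa>' mult_left_mono[of "- 1" "sin \<phi>" \<kappa>'] by simp
  have Y_deriv: "(Y has_real_derivative R' (\<kappa>' * sin \<phi>) * (\<kappa>' * cos \<phi>)) (at \<phi>)" for \<phi>
    unfolding Y_def by (intro DERIV_chain2[OF R_has_derivative] DERIV_cmult DERIV_sin ge)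
  have R_k: "R \<kappa>' = (- 1) ^ k * M"
    using R_x[of k] by (simp add: x_k)
  \<comment> \<open>The reciprocity R(-\<kappa>') R(\<kappa>') = 1 determines \<open>S\<close> at
    the left end.\<close>
  have "poly p \<kappa>' \<noteq> 0"
    using poly_uminus(1)[of \<kappa>'] poly_pt_pos[of "- \<kappa>'"] by auto
  then have "R (- \<kappa>') * R \<kappa>' = 1"
    using poly_uminus[of \<kappa>'] poly_pt_pos[of \<kappa>'] \<kappa>' by (simp add: R_eq)
  then have "(R (- \<kappa>'))\<^sup>2 * (R \<kappa>')\<^sup>2 = 1"
    by (simp flip: power_mult_distrib)
  then have "(R (- \<kappa>'))\<^sup>2 * M\<^sup>2 = 1"
    by (simp add: R_k power_mult_distrib flip: power_mult)
  then have S_ends: "S (pi / 2) = 1" "S (- (pi / 2)) = 0"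
    using \<mu> M4 by (simp_all add: S_def Y_def R_k power_mult_distrib power_mult[symmetric] mult.commute flip: power_add)
  have S_range: "0 < S \<phi>" "S \<phi> < 1" "0 < (Y \<phi>)\<^sup>2 - M\<^sup>2" "0 < 1 - M\<^sup>2 * (Y \<phi>)\<^sup>2"
    "- \<kappa>' < \<kappa>' * sin \<phi>" "\<kappa>' * sin \<phi> < \<kappa>'"
    if "- (pi / 2) < \<phi>" "\<phi> < pi / 2" for \<phi>
  proof -
    define t where "t = \<kappa>' * sin \<phi>"
    have "sin (- (pi / 2)) < sin \<phi>" "sin \<phi> < sin (pi / 2)"
      using that by (intro sin_monotone_2pi; simp)+
    then have t: "- \<kappa>' < t" "t < \<kappa>'"
      unfolding t_def using \<kappa>' mult_strict_left_mono[of "- 1" "sin \<phi>" \<kappa>'] by simp_all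
    then show "- \<kappa>' < \<kappa>' * sin \<phi>" "\<kappa>' * sin \<phi> < \<kappa>'" by (simp_all add: t_def)
    have x_gt: "\<kappa>' \<le> x i" if "i \<in> {1..<k}" for i
      using x_bounds[of i] that by auto
    then have "x i \<noteq> t" "x i \<noteq> - t" if "i \<in> {1..<k}" for i
      using t that by force+
    then have q: "q t \<noteq> 0" "q (- t) \<noteq> 0"
      by (force simp: q_def)+
    have pt: "0 < poly pt t" using t by (intro poly_pt_pos) auto
    have "0 < (1 - M\<^sup>2) * ((1 - t) * (\<kappa>' - t) * (q t)\<^sup>2) / (poly pt t)\<^sup>2"
      using t \<kappa>' M_sq q pt by (intro divide_pos_pos mult_pos_pos) auto
    also have "\<dots> = - (M\<^sup>2 - (R t)\<^sup>2)"
      unfolding R_sq[OF less_imp_le[OF t(1)]] minus_divide_left by (simp add: algebra_simps)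
    finally show p1: "0 < (Y \<phi>)\<^sup>2 - M\<^sup>2" by (simp add: Y_def t_def)
    have "0 < 1 - M\<^sup>2 * (R t)\<^sup>2"
      unfolding R_sq'[OF less_imp_le[OF t(1)]] using t \<kappa>' M_sq q pt
      by (intro divide_pos_pos mult_pos_pos) auto
    then show p2: "0 < 1 - M\<^sup>2 * (Y \<phi>)\<^sup>2" by (simp add: Y_def t_def)
    then show "0 < S \<phi>" using \<mu>(2) by (simp add: S_def)
    have "M\<^sup>2 * M\<^sup>2 < M\<^sup>2 * (Y \<phi>)\<^sup>2"
      using p1 M_sq by (intro mult_strict_left_mono) auto
    then show "S \<phi> < 1" using \<mu> M4 by (simp add: S_def flip: power_add)
  qed
  have "G (pi / 2) = G (- (pi / 2))"
  proof (rule DERIV_isconst_end[where f=G and a="- (pi / 2)" and b="pi / 2"])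
    have "0 \<le> S \<phi> \<and> S \<phi> \<le> 1" if \<phi>: "\<phi> \<in> {- (pi / 2)..pi / 2}" for \<phi>
    proof -
      consider "\<phi> = - (pi / 2)" | "\<phi> = pi / 2" | "- (pi / 2) < \<phi>" "\<phi> < pi / 2"
        using \<phi> by fastforce
      then show ?thesis
      proof cases
        case 3
        then show ?thesis using S_range[of \<phi>] by auto
      qed (simp_all only: S_ends order_refl zero_le_one simp_thms)
    qed
    note S_bound = this
    have "continuous_on {- (pi / 2)..pi / 2} Y"
      using Y_deriv by (meson DERIV_isCont continuous_at_imp_continuous_on)
    then have "continuous_on {- (pi / 2)..pi / 2} S"
      using \<mu> unfolding S_def by (intro continuous_intros) auto
    then have "continuous_on {- (pi / 2)..pi / 2} (\<lambda>\<phi>. sqrt (S \<phi>))"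
      by (rule continuous_on_real_sqrt)
    moreover have "- 1 \<le> sqrt (S \<phi>) \<and> sqrt (S \<phi>) \<le> 1" if "\<phi> \<in> {- (pi / 2)..pi / 2}" for \<phi>
      using S_bound[OF that] order_trans[of "- 1" 0 "sqrt (S \<phi>)"] by simp
    ultimately have "continuous_on {- (pi / 2)..pi / 2} (\<lambda>\<phi>. arcsin (sqrt (S \<phi>)))"
      by (intro continuous_on_arcsin) auto
    from continuous_on_compose2[OF m.F_cont this subset_UNIV]
    show "continuous_on {- (pi / 2)..pi / 2} G"
      unfolding G_def by (intro continuous_on_diff continuous_on_mult continuous_on_const k'.F_cont)
  next
    fix \<phi> assume \<phi>: "- (pi / 2) < \<phi>" "\<phi> < pi / 2"
    note S = S_range[OF \<phi>]
    define t y D where "t = \<kappa>' * sin \<phi>" "y = Y \<phi>" "D = R' t * (\<kappa>' * cos \<phi>)"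
    note defs = this
    have Y': "(Y has_real_derivative D) (at \<phi>)" using Y_deriv by (simp add: defs)
    have y: "y \<noteq> 0" using S(3) M_sq by (auto simp: defs)
    have "(S has_real_derivative - (2 * M\<^sup>2 * y * D) / \<mu>\<^sup>2) (at \<phi>)"
      unfolding S_def using \<mu>(2)
      by (auto intro!: derivative_eq_intros Y' simp: defs field_simps)
    then have "((\<lambda>\<phi>. sqrt (S \<phi>)) has_real_derivative inverse (sqrt (S \<phi>)) / 2 * (- (2 * M\<^sup>2 * y * D) / \<mu>\<^sup>2)) (at \<phi>)"
      by (intro DERIV_chain2[OF DERIV_real_sqrt] S(1))
    then have F': "((\<lambda>\<phi>. m.F (arcsin (sqrt (S \<phi>)))) has_real_derivative
        inverse (sqrt (S \<phi>)) / 2 * (- (2 * M\<^sup>2 * y * D) / \<mu>\<^sup>2) /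
        (sqrt (1 - \<mu>\<^sup>2 * (sqrt (S \<phi>))\<^sup>2) * sqrt (1 - (sqrt (S \<phi>))\<^sup>2))) (at \<phi>)"
      using S(1,2) by (intro m.F_arcsin_deriv) auto
    define A B where "A = sqrt (y\<^sup>2 - M\<^sup>2)" "B = sqrt (1 - M\<^sup>2 * y\<^sup>2)"
    note AB = this
    have AB_pos: "0 < A" "0 < B" using S(3,4) by (auto simp: AB defs)
    have s1: "sqrt (S \<phi>) = B / \<mu>"
      using \<mu>(2) by (simp add: S_def AB defs real_sqrt_divide)
    \<comment> \<open>\<open>S\<close> and \<mu> are matched so that both radicands simplify: this
      one is a multiple of y^2 - M^2, the one in \<open>s3\<close> is (M y)^2.\<close>
    have "1 - (sqrt (S \<phi>))\<^sup>2 = M\<^sup>2 * (y\<^sup>2 - M\<^sup>2) / \<mu>\<^sup>2"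
    proof -
      have "(sqrt (S \<phi>))\<^sup>2 = (1 - M\<^sup>2 * y\<^sup>2) / \<mu>\<^sup>2" using S(1) by (simp add: S_def defs)
      then have "1 - (sqrt (S \<phi>))\<^sup>2 = (\<mu>\<^sup>2 - (1 - M\<^sup>2 * y\<^sup>2)) / \<mu>\<^sup>2"
        using \<mu>(2) by (simp add: diff_divide_distrib)
      also have "\<mu>\<^sup>2 - (1 - M\<^sup>2 * y\<^sup>2) = M\<^sup>2 * (y\<^sup>2 - M\<^sup>2)"
        unfolding \<mu> by (simp add: algebra_simps flip: power_add)
      finally show ?thesis .
    qed
    then have s2: "sqrt (1 - (sqrt (S \<phi>))\<^sup>2) = M * A / \<mu>"
      using \<mu>(2) M_bounds by (simp add: AB real_sqrt_divide real_sqrt_mult)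
    have "1 - \<mu>\<^sup>2 * (sqrt (S \<phi>))\<^sup>2 = M\<^sup>2 * y\<^sup>2"
      using \<mu>(2) S(1) by (simp add: S_def defs)
    then have s3: "sqrt (1 - \<mu>\<^sup>2 * (sqrt (S \<phi>))\<^sup>2) = M * \<bar>y\<bar>"
      using M_bounds by (simp add: real_sqrt_mult)
    have c_pos': "0 < cos \<phi>" using \<phi> by (intro cos_gt_zero_pi) auto
    define E where "E = sqrt (1 - \<kappa>'\<^sup>2 * (sin \<phi>)\<^sup>2)"
    have E: "0 < E" "E\<^sup>2 = 1 - t\<^sup>2"
      using k'.radicand_pos[of \<phi>] by (auto simp: E_def defs power_mult_distrib)
    have "(D * E)\<^sup>2 = (R' t)\<^sup>2 * ((1 - t\<^sup>2) * (\<kappa>'\<^sup>2 * (cos \<phi>)\<^sup>2))"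
      unfolding power_mult_distrib E by (simp add: defs power_mult_distrib)
    also have "\<kappa>'\<^sup>2 * (cos \<phi>)\<^sup>2 = - (t\<^sup>2 - \<kappa>'\<^sup>2)"
      by (simp add: defs cos_squared_eq power_mult_distrib algebra_simps)
    \<comment> \<open>In this range one factor on each side of \<open>R_ode\<close> is negative; the
      two signs are moved out.\<close>
    also have "(R' t)\<^sup>2 * ((1 - t\<^sup>2) * - (t\<^sup>2 - \<kappa>'\<^sup>2)) = - ((R' t)\<^sup>2 * ((1 - t\<^sup>2) * (t\<^sup>2 - \<kappa>'\<^sup>2)))"
      by (simp only: mult_minus_right)
    also have "\<dots> = c\<^sup>2 * ((y\<^sup>2 - M\<^sup>2) * (1 - M\<^sup>2 * y\<^sup>2))"
      unfolding defs Y_def R_ode[OF ge] by (simp add: algebra_simps)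
    also have "\<dots> = (c * A * B)\<^sup>2"
      using S(3,4) by (simp add: AB power_mult_distrib defs)
    finally have "\<bar>D * E\<bar> = c * A * B"
      using c_pos AB_pos by (metis abs_of_pos mult_pos_pos power2_eq_iff abs_minus_cancel)
    \<comment> \<open>This resolves the absolute value: \<open>S\<close> increases because R^2
      decreases.\<close>
    moreover have yD: "y * D < 0"
    proof -
      have "- \<kappa>' < t" "t < \<kappa>'"
        using S_range(5,6)[OF \<phi>] by (simp_all add: defs)
      then have "y * R' t < 0" using R_R'_neg[of t] by (simp add: defs Y_def)
      from mult_neg_pos[OF this mult_pos_pos[OF \<kappa>'(1) c_pos']] show ?thesis
        by (simp only: defs(3) mult.assoc)
    qed
    then have "\<bar>y\<bar> * \<bar>D * E\<bar> = - (y * D) * E"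
      using E(1) by (simp add: abs_mult[symmetric] mult.assoc[symmetric] abs_mult_pos[symmetric])
    ultimately have "\<bar>y\<bar> * (c * A * B) = - (y * D) * E"
      by simp
    then have "- (y * D) = \<bar>y\<bar> * (c * A * B) / E" using E by (simp add: field_simps)
    have "inverse (sqrt (S \<phi>)) / 2 * (- (2 * M\<^sup>2 * y * D) / \<mu>\<^sup>2) /
        (sqrt (1 - \<mu>\<^sup>2 * (sqrt (S \<phi>))\<^sup>2) * sqrt (1 - (sqrt (S \<phi>))\<^sup>2)) =
        inverse (B / \<mu>) * (M\<^sup>2 * (- (y * D)) / \<mu>\<^sup>2) / (M * \<bar>y\<bar> * (M * A / \<mu>))"
      unfolding s2 s3 unfolding s1 by simp
    also have "\<dots> = c * (1 / E)"
      unfolding \<open>- (y * D) = _\<close> using AB_pos \<mu>(2) M_bounds y E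
      by (simp add: power2_eq_square)
    finally have F'': "((\<lambda>\<phi>. m.F (arcsin (sqrt (S \<phi>)))) has_real_derivative c * (1 / E)) (at \<phi>)"
      using F' by simp
    have "(G has_real_derivative c * (1 / E) - c * (1 / E)) (at \<phi>)"
      unfolding G_def by (intro DERIV_diff DERIV_cmult F'') (simp add: E_def k'.F_deriv)
    then show "(G has_real_derivative 0) (at \<phi>)" by simp
  qed simp
  then show ?thesis
    using k'.F_odd[of "pi / 2"] unfolding G_def S_ends M2 \<mu>_def[symmetric]
    by (simp add: elliptic_K_def m.F_0)
qed


text \<open>In \<open>2\<close> both integrals have been inserted into the ratio bound at M^2, and
  \<open>c\<close> cancels on its left. In \<open>1\<close> the bound is taken at \<kappa>', whose
  complementary modulus is \<kappa>; it bounds KK / K(\<kappa>') from above and so the left side of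
  \<open>2\<close> from below.\<close>

lemma M_sq_le: "M\<^sup>2 \<le> 4 * exp (- (real k * pi\<^sup>2 / ln (4 / \<kappa>')))"
proof -
  interpret k': elliptic_modulus \<kappa>'
    using \<kappa>' by unfold_locales auto
  define L where "L = ln (4 / \<kappa>')"
  have "1 < 4 / \<kappa>'" using \<kappa>' by (simp add: less_divide_eq)
  then have L: "0 < L" unfolding L_def by (rule ln_gt_zero)
  have "sqrt (1 - \<kappa>'\<^sup>2) = \<kappa>" using \<kappa>' nonneg by simp
  then have 1: "pi * KK / (2 * k'.KK) \<le> L"
    using elliptic_K_ratio_le[of \<kappa>'] \<kappa>' by (simp add: L_def)
  have "pi * elliptic_K (sqrt (1 - (M\<^sup>2)\<^sup>2)) / (2 * elliptic_K (M\<^sup>2)) \<le> ln (4 / M\<^sup>2)"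
    using M_sq by (intro elliptic_K_ratio_le)
  then have 2: "pi * (2 * c * k'.KK) / (c * h) \<le> ln (4 / M\<^sup>2)"
    unfolding elliptic_K_M elliptic_K_M_complement .
  have "pi * KK \<le> L * (2 * k'.KK)"
    using 1 k'.KK_pos by (simp add: divide_le_eq)
  then have "pi / L \<le> 2 * k'.KK / KK"
    using L KK_pos by (simp add: field_simps)
  then have "real k * pi * (pi / L) \<le> real k * pi * (2 * k'.KK / KK)"
    by (intro mult_left_mono) auto
  also have "\<dots> = pi * (2 * c * k'.KK) / (c * h)"
    using c_pos KK_pos k_pos by (simp add: h_def field_simps)
  also note 2
  finally have "real k * pi\<^sup>2 / L \<le> ln (4 / M\<^sup>2)"
    by (simp add: power2_eq_square)
  then have "exp (real k * pi\<^sup>2 / L) \<le> 4 / M\<^sup>2"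
    using M_sq exp_le_cancel_iff[of "real k * pi\<^sup>2 / L" "ln (4 / M\<^sup>2)"] by simp
  then show ?thesis
    using M_sq unfolding L_def[symmetric] exp_minus by (simp add: field_simps)
qed

end

section \<open>The interval parameter delta and the pull-back by the Moebius transformation\<close>

lemma abs_sin_mult_le: "\<bar>sin (real m * x)\<bar> \<le> real m * \<bar>sin x\<bar>"
proof (induction m)
  case (Suc m)
  have "sin (real (Suc m) * x) = sin (real m * x) * cos x + cos (real m * x) * sin x"
    by (simp add: algebra_simps sin_add)
  then have "\<bar>sin (real (Suc m) * x)\<bar> \<le> \<bar>sin (real m * x)\<bar> * \<bar>cos x\<bar> + \<bar>cos (real m * x)\<bar> * \<bar>sin x\<bar>"
    by (metis abs_mult abs_triangle_ineq)
  also have "\<dots> \<le> \<bar>sin (real m * x)\<bar> * 1 + 1 * \<bar>sin x\<bar>"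
    by (intro add_mono mult_left_mono mult_right_mono) auto
  finally show ?case using Suc by (simp add: algebra_simps)
qed simp

text \<open>With x = pi / n, gamma is the square of sin (m x) / sin x, hence at most m^2, and
  \<delta> < 4 gamma. Here 2 m \<le> n keeps m x \<le> pi / 2, where sin increases, and 2 \<le> m
  makes gamma > 1. The consequence 4 \<delta> \<le> (4 m)^2 is the source of 4 m in \<xi>.\<close>

lemma zol_delta_bounds:
  assumes "2 \<le> m" "2 * m \<le> n"
  shows "1 < zol_delta n m" "zol_delta n m \<le> 4 * (real m)\<^sup>2"
proof -
  have n: "0 < real n" "2 * real m \<le> real n" using assms by linarith+
  define x where "x = pi / real n"
  have args: "(arc_beta n m + arc_alpha n m) / 2 = real m * x" "(arc_beta n m - arc_alpha n m) / 2 = x"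
    by (simp_all add: arc_beta_def arc_alpha_def x_def[symmetric] algebra_simps)
  have x: "0 < x" "x < real m * x" "real m * x \<le> pi / 2"
    using n assms by (auto simp: x_def field_simps)
  have s: "0 < sin x" "sin x < sin (real m * x)"
  proof -
    have "x < pi / 2" using x by linarith
    then show "0 < sin x" using x pi_half_gt_zero by (intro sin_gt_zero) linarith+
    show "sin x < sin (real m * x)" using x pi_half_gt_zero by (intro sin_monotone_2pi) linarith+
  qed
  define g where "g = zol_gamma n m"
  have g: "g = (sin (real m * x) / sin x)\<^sup>2"
    by (simp add: g_def zol_gamma_def args)
  have "1 < sin (real m * x) / sin x" using s by simp
  then have "1 < g" unfolding g by (simp add: one_less_power)
  have "sin (real m * x) / sin x \<le> real m"
    using abs_sin_mult_le[of m x] s by (simp add: divide_le_eq)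
  then have "g \<le> (real m)\<^sup>2"
    unfolding g using s by (intro power_mono) auto
  have "0 \<le> g\<^sup>2 - g" using \<open>1 < g\<close> by (simp add: power2_eq_square)
  then have "0 \<le> sqrt (g\<^sup>2 - g)" by simp
  then show "1 < zol_delta n m"
    unfolding zol_delta_def g_def[symmetric] using \<open>1 < g\<close> by linarith
  have "sqrt (g\<^sup>2 - g) \<le> sqrt (g\<^sup>2)" using \<open>1 < g\<close> by (intro real_sqrt_le_mono) simp
  then have "sqrt (g\<^sup>2 - g) \<le> g" using \<open>1 < g\<close> by simp
  then show "zol_delta n m \<le> 4 * (real m)\<^sup>2"
    unfolding zol_delta_def g_def[symmetric] using \<open>g \<le> (real m)\<^sup>2\<close> \<open>1 < g\<close> by linarith
qed

text \<open>In a cross ratio of four images the determinant and all denominators of this formula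
  cancel.\<close>

lemma moebius_diff:
  fixes a b c d x y :: "'a::field"
  assumes "c * x + d \<noteq> 0" "c * y + d \<noteq> 0"
  shows "(a * x + b) / (c * x + d) - (a * y + b) / (c * y + d)
    = (a * d - b * c) * (x - y) / ((c * x + d) * (c * y + d))"
  using assms by (simp add: diff_frac_eq) (simp add: algebra_simps)

text \<open>With l = T(-\<delta> s) and u = T(\<delta> t), each cross ratio is a factor of R(s)
  times one of R(t), where s and t lie in [1/\<delta>, 1]; this is how M^2 arises. The disequalities
  rest on the same injectivity of \<open>T\<close> and keep the divisions of fADI proper.\<close>

lemma zolotarev_ratio_le:
  fixes n m k :: nat and K :: "nat set" and T :: "complex \<Rightarrow> complex"
  assumes m: "2 \<le> m" "2 * m \<le> n" and k: "1 \<le> k" and T: "zol_moebius n m K T"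
    and l: "l \<in> arc_J n m K" and u: "u \<in> arc_K n m K"
  defines "\<tau> \<equiv> zol_tau n m T k" and "\<nu> \<equiv> zol_nu n m T k"
  shows "cmod (\<Prod>j\<in>{1..k}. (l - \<tau> j) * (u - \<nu> j) / ((l - \<nu> j) * (u - \<tau> j)))
      \<le> 4 * exp (- (real k * pi\<^sup>2 / (2 * ln (4 * real m))))" (is ?A)
    and "j \<in> {1..k} \<Longrightarrow> l \<noteq> \<nu> j" and "j \<in> {1..k} \<Longrightarrow> u \<noteq> \<tau> j"
    and "j \<in> {1..k} \<Longrightarrow> \<tau> j \<noteq> \<nu> j"
    and "l \<noteq> u"
proof -
  define \<delta> where "\<delta> = zol_delta n m"
  have \<delta>: "1 < \<delta>" "\<delta> \<le> 4 * (real m)\<^sup>2"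
    using zol_delta_bounds[OF m] by (auto simp: \<delta>_def)
  define \<Xi> where "\<Xi> = zol_Xi n m"
  have \<Xi>: "\<Xi> = sqrt (1 - 1 / \<delta>\<^sup>2)" by (simp add: \<Xi>_def zol_Xi_def \<delta>_def)
  have d2: "0 < 1 / \<delta>\<^sup>2" "1 / \<delta>\<^sup>2 < 1" using \<delta> by (auto simp: one_less_power)
  interpret z: zolotarev_nodes \<Xi> k
    using d2 k by unfold_locales (auto simp: \<Xi> real_sqrt_lt_1_iff)
  have \<kappa>': "z.\<kappa>' = 1 / \<delta>"
  proof -
    have "\<Xi>\<^sup>2 = 1 - 1 / \<delta>\<^sup>2" using d2 by (simp add: \<Xi>)
    then show ?thesis using \<delta> by (simp add: z.\<kappa>'_def real_sqrt_divide)
  qed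
  \<comment> \<open>The shifts are numbered from 1, the nodes \<open>a\<close> from 0.\<close>
  have dn: "zol_dn n m k j = z.a (j - 1)" if "j \<in> {1..k}" for j
    unfolding zol_dn_def \<Xi>_def[symmetric] z.a_def z.b_def using that by (simp add: of_nat_diff)
  obtain a b c d where abcd: "a * d - b * c \<noteq> 0" and T_eq: "T = (\<lambda>z. (a * z + b) / (c * z + d))"
    using T by (auto simp: zol_moebius_def is_moebius_def)
  have TJ: "T ` complex_of_real ` {- \<delta>..- 1} = arc_J n m K"
    and TK: "T ` complex_of_real ` {1..\<delta>} = arc_K n m K"
    using T by (auto simp: zol_moebius_def \<delta>_def)
  \<comment> \<open>At its pole \<open>T\<close> takes the value 0 by the convention on division,
    whereas both arcs lie on the unit circle.\<close>
  have den: "c * complex_of_real x + d \<noteq> 0" if "x \<in> {- \<delta>..- 1} \<union> {1..\<delta>}" for x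
  proof
    assume "c * complex_of_real x + d = 0"
    then have "T (complex_of_real x) = 0" by (simp add: T_eq)
    moreover have "T (complex_of_real x) \<in> arc_J n m K \<union> arc_K n m K"
      using that unfolding TJ[symmetric] TK[symmetric] by auto
    ultimately show False by (auto simp: arc_J_def arc_K_def)
  qed
  have T_diff: "T (complex_of_real x) - T (complex_of_real y) = (a * d - b * c) * complex_of_real (x - y) /
      ((c * complex_of_real x + d) * (c * complex_of_real y + d))"
    if "x \<in> {- \<delta>..- 1} \<union> {1..\<delta>}" "y \<in> {- \<delta>..- 1} \<union> {1..\<delta>}" for x y
    unfolding T_eq moebius_diff[OF den[OF that(1)] den[OF that(2)]] by simp
  have T_ne: "T (complex_of_real x) \<noteq> T (complex_of_real y)"
    if "x \<in> {- \<delta>..- 1} \<union> {1..\<delta>}" "y \<in> {- \<delta>..- 1} \<union> {1..\<delta>}" "x \<noteq> y" for x y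
    using T_diff[OF that(1,2)] that(3) abcd den[OF that(1)] den[OF that(2)] by auto
  obtain s where s: "l = T (complex_of_real (- \<delta> * s))" "1 / \<delta> \<le> s" "s \<le> 1"
  proof -
    obtain x where x: "l = T (complex_of_real x)" "x \<in> {- \<delta>..- 1}"
      using l unfolding TJ[symmetric] by auto
    show ?thesis using x \<delta> by (intro that[of "- x / \<delta>"]) (auto simp: field_simps)
  qed
  obtain t where t: "u = T (complex_of_real (\<delta> * t))" "1 / \<delta> \<le> t" "t \<le> 1"
  proof -
    obtain x where x: "u = T (complex_of_real x)" "x \<in> {1..\<delta>}"
      using u unfolding TK[symmetric] by auto
    show ?thesis using x \<delta> by (intro that[of "x / \<delta>"]) (auto simp: field_simps)
  qed
  define e where "e = (\<lambda>j. z.a (j - 1))"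
  have tau: "\<tau> j = T (complex_of_real (- \<delta> * e j))" and nu: "\<nu> j = T (complex_of_real (\<delta> * e j))"
    if "j \<in> {1..k}" for j
    using dn[OF that] by (auto simp: \<tau>_def \<nu>_def zol_tau_def zol_nu_def \<delta>_def e_def)
  have e: "1 / \<delta> \<le> e j" "e j \<le> 1" if "j \<in> {1..k}" for j
  proof -
    have "j - 1 < k" using that by auto
    then show "1 / \<delta> \<le> e j" "e j \<le> 1"
      using z.a_bounds[of "j - 1"] by (auto simp: e_def \<kappa>')
  qed
  have in_J: "- \<delta> * r \<in> {- \<delta>..- 1} \<union> {1..\<delta>}" and in_K: "\<delta> * r \<in> {- \<delta>..- 1} \<union> {1..\<delta>}"
    if "1 / \<delta> \<le> r" "r \<le> 1" for r
    using that \<delta> by (auto simp: field_simps)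
  have neq: "- \<delta> * r \<noteq> \<delta> * r'" if "1 / \<delta> \<le> r" "1 / \<delta> \<le> r'" for r r'
  proof -
    have "0 < 1 / \<delta>" using \<delta> by simp
    then have "0 < r" "0 < r'" using that by linarith+
    then have "- \<delta> * r < 0" "0 < \<delta> * r'" using \<delta> by auto
    then show ?thesis by linarith
  qed
  show "l \<noteq> \<nu> j" "u \<noteq> \<tau> j" "\<tau> j \<noteq> \<nu> j" if j: "j \<in> {1..k}" for j
    unfolding s(1) t(1) tau[OF j] nu[OF j]
    using T_ne[OF in_J[OF s(2,3)] in_K[OF e[OF j]] neq[OF s(2) e(1)[OF j]]]
      T_ne[OF in_J[OF e[OF j]] in_K[OF t(2,3)] neq[OF e(1)[OF j] t(2)]]
      T_ne[OF in_J[OF e[OF j]] in_K[OF e[OF j]] neq[OF e(1)[OF j] e(1)[OF j]]] by metis+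
  show "l \<noteq> u"
    unfolding s(1) t(1) using T_ne[OF in_J[OF s(2,3)] in_K[OF t(2,3)] neq[OF s(2) t(2)]] .
  have factor: "(l - \<tau> j) * (u - \<nu> j) / ((l - \<nu> j) * (u - \<tau> j))
      = complex_of_real (((s - e j) / (s + e j)) * ((t - e j) / (t + e j)))" if j: "j \<in> {1..k}" for j
  proof -
    note in_s = in_J[OF s(2,3)] and in_t = in_K[OF t(2,3)]
      and in_tau = in_J[OF e[OF j]] and in_nu = in_K[OF e[OF j]]
    have "(l - \<tau> j) * (u - \<nu> j) / ((l - \<nu> j) * (u - \<tau> j)) =
      complex_of_real (- \<delta> * s - - \<delta> * e j) * complex_of_real (\<delta> * t - \<delta> * e j) /
      (complex_of_real (- \<delta> * s - \<delta> * e j) * complex_of_real (\<delta> * t - - \<delta> * e j))"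
      unfolding s(1) t(1) tau[OF j] nu[OF j]
        T_diff[OF in_s in_tau] T_diff[OF in_s in_nu] T_diff[OF in_t in_tau] T_diff[OF in_t in_nu]
      using abcd den[OF in_s] den[OF in_t] den[OF in_tau] den[OF in_nu] by simp
    also have "\<dots> = complex_of_real ((- \<delta> * s - - \<delta> * e j) * (\<delta> * t - \<delta> * e j) /
      ((- \<delta> * s - \<delta> * e j) * (\<delta> * t - - \<delta> * e j)))"
      by simp
    also have "(- \<delta> * s - - \<delta> * e j) * (\<delta> * t - \<delta> * e j) / ((- \<delta> * s - \<delta> * e j) * (\<delta> * t - - \<delta> * e j))
      = ((- \<delta> * \<delta>) * ((s - e j) * (t - e j))) / ((- \<delta> * \<delta>) * ((s + e j) * (t + e j)))"
      by (simp add: algebra_simps)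
    also have "\<dots> = ((s - e j) / (s + e j)) * ((t - e j) / (t + e j))"
      using \<delta> by simp
    finally show ?thesis .
  qed
  have R_eq: "(\<Prod>j\<in>{1..k}. (r - e j) / (r + e j)) = z.R r" for r
    unfolding z.R_def e_def
    by (rule prod.reindex_bij_witness[of _ Suc "\<lambda>j. j - 1"]) auto
  have "(\<Prod>j\<in>{1..k}. (l - \<tau> j) * (u - \<nu> j) / ((l - \<nu> j) * (u - \<tau> j))) = complex_of_real (z.R s * z.R t)"
    unfolding R_eq[symmetric] prod.distrib[symmetric] of_real_prod
    by (intro prod.cong refl factor)
  then have "cmod (\<Prod>j\<in>{1..k}. (l - \<tau> j) * (u - \<nu> j) / ((l - \<nu> j) * (u - \<tau> j))) = \<bar>z.R s\<bar> * \<bar>z.R t\<bar>"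
    by (simp add: norm_of_real abs_mult del: of_real_mult)
  also have "\<dots> \<le> z.M * z.M"
    using s t z.M_bounds by (intro mult_mono z.abs_R_le) (auto simp: \<kappa>')
  also have "\<dots> \<le> 4 * exp (- (real k * pi\<^sup>2 / ln (4 / z.\<kappa>')))"
    using z.M_sq_le by (simp add: power2_eq_square)
  also have "\<dots> \<le> 4 * exp (- (real k * pi\<^sup>2 / (2 * ln (4 * real m))))"
  proof -
    have "4 * \<delta> \<le> (4 * real m)\<^sup>2" using \<delta> by (simp add: power_mult_distrib)
    then have "ln (4 * \<delta>) \<le> ln ((4 * real m)\<^sup>2)" using \<delta> m by (subst ln_le_cancel_iff) auto
    also have "\<dots> = 2 * ln (4 * real m)" using m by (subst ln_realpow) auto
    finally have "ln (4 * \<delta>) \<le> 2 * ln (4 * real m)" .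
    moreover have "0 < ln (4 * \<delta>)" using \<delta> by (intro ln_gt_zero) linarith
    ultimately have "real k * pi\<^sup>2 / (2 * ln (4 * real m)) \<le> real k * pi\<^sup>2 / ln (4 * \<delta>)"
      by (intro divide_left_mono) auto
    then show ?thesis by (simp add: \<kappa>')
  qed
  finally show ?A .
qed

section \<open>Factored ADI for diagonal coefficients\<close>

text \<open>The product is a sum of r outer products, each of rank at most 1; \<open>S l\<close> is
  the sum of the first l of them.\<close>

lemma (in vec_space) rank_mult_le_inner_dim:
  assumes A: "A \<in> carrier_mat n r" and B: "B \<in> carrier_mat r nc"
  shows "rank (A * B) \<le> r"
proof -
  define S where "S = (\<lambda>l. mat n nc (\<lambda>(i, j). \<Sum>t<l. A $$ (i, t) * B $$ (t, j)))"
  have "rank (S l) \<le> l" for l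
  proof (induction l)
    case 0
    have "S 0 = 0\<^sub>m n nc" by (intro eq_matI) (auto simp: S_def)
    then show ?case by (simp add: rank_0I)
  next
    case (Suc l)
    define U where "U = mat n nc (\<lambda>(i, j). A $$ (i, l) * B $$ (l, j))"
    have "S (Suc l) = S l + U" by (intro eq_matI) (auto simp: S_def U_def)
    moreover have "rank U \<le> 1"
      by (rule rank_le_1_product_entries[where f="\<lambda>i. A $$ (i, l)" and g="\<lambda>j. B $$ (l, j)"])
        (auto simp: U_def)
    moreover have "rank (S l + U) \<le> rank (S l) + rank U"
      by (rule rank_subadditive) (auto simp: S_def U_def)
    ultimately show ?case using Suc by simp
  qed
  moreover have "A * B = S r"
    using A B by (intro eq_matI) (auto simp: S_def scalar_prod_def lessThan_atLeast0)
  ultimately show ?thesis by simp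
qed

lemma dim_mat_adjoint [simp]: "dim_row (mat_adjoint A) = dim_col A" "dim_col (mat_adjoint A) = dim_row A"
  by (simp_all add: mat_adjoint_def)

lemma index_mat_adjoint:
  "i < dim_col A \<Longrightarrow> j < dim_row A \<Longrightarrow> mat_adjoint A $$ (i, j) = conjugate (A $$ (j, i))"
  by (simp add: mat_adjoint_def mat_of_rows_index)

lemma mat_adjoint_mat_diag: "mat_adjoint (mat_diag n f) = mat_diag n (\<lambda>i. conjugate (f i))"
  by (intro eq_matI) (auto simp: index_mat_adjoint mat_diag_def)

lemma shifted_mat_diag: "shifted (mat_diag n f) s = mat_diag n (\<lambda>i. f i - s)"
  by (intro eq_matI) (auto simp: shifted_def mat_diag_def)

text \<open>\<open>inv_mat\<close> takes \<open>the\<close> of an option, so invertibility comes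
  first, as membership in \<open>Units\<close>; the inverse obtained is then identified by
  uniqueness.\<close>

lemma inv_mat_mat_diag:
  assumes "\<And>i. i < n \<Longrightarrow> f i \<noteq> 0"
  shows "inv_mat (mat_diag n f) = mat_diag n (\<lambda>i. 1 / f i)"
proof -
  let ?A = "mat_diag n f" and ?B = "mat_diag n (\<lambda>i. 1 / f i)"
  have AB: "?A * ?B = 1\<^sub>m n" and BA: "?B * ?A = 1\<^sub>m n"
    unfolding mat_diag_diag using assms by (auto simp: mat_diag_def intro!: eq_matI)
  have "?A \<in> Units (ring_mat TYPE(complex) n ())"
    unfolding Units_def using AB BA by (auto simp: ring_mat_simps intro!: bexI[of _ ?B])
  then obtain C where C: "mat_inverse ?A = Some C"
    using mat_inverse(1)[of ?A n "()"] by (cases "mat_inverse ?A") auto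
  then have CA: "C * ?A = 1\<^sub>m n" "C \<in> carrier_mat n n"
    using mat_inverse(2)[of ?A n] by auto
  have "C = C * (?A * ?B)" unfolding AB using CA by simp
  also have "\<dots> = (C * ?A) * ?B" using CA by (intro assoc_mult_mat[symmetric, of _ n n _ n _ n]) auto
  also have "\<dots> = ?B" unfolding CA by (rule left_mult_one_mat[of _ n n]) (simp add: mat_diag_def)
  finally show ?thesis using C by (simp add: inv_mat_def)
qed

lemma inv_mat_shifted:
  assumes "\<And>i. i < n \<Longrightarrow> f i \<noteq> s"
  shows "inv_mat (shifted (mat_diag n f) s) = mat_diag n (\<lambda>i. 1 / (f i - s))"
  unfolding shifted_mat_diag using assms by (intro inv_mat_mat_diag) auto

text \<open>On diagonal data each iterate is a row scaling of \<open>G\<close>. The recursion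
  divides by \<nu> j - \<tau> j, hence \<open>ne'\<close>; the index \<open>Suc l\<close> avoids the
  unspecified value at 0.\<close>

lemma fadi_Z_diag:
  assumes G: "G \<in> carrier_mat r \<rho>"
    and ne: "\<And>i j. i < r \<Longrightarrow> j \<in> {1..Suc l} \<Longrightarrow> f i \<noteq> \<nu> j"
    and ne': "\<And>j. j \<in> {1..Suc l} \<Longrightarrow> \<tau> j \<noteq> \<nu> j"
  shows "fadi_Z (mat_diag r f) G \<tau> \<nu> (Suc l) = mat r \<rho> (\<lambda>(i, c).
    (\<nu> (Suc l) - \<tau> (Suc l)) / (f i - \<nu> (Suc l)) * (\<Prod>t\<in>{1..l}. (f i - \<tau> t) / (f i - \<nu> t)) * G $$ (i, c))"
  using ne ne'
proof (induction l)
  case 0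
  have "inv_mat (shifted (mat_diag r f) (\<nu> 1)) = mat_diag r (\<lambda>i. 1 / (f i - \<nu> 1))"
    using 0 by (intro inv_mat_shifted) auto
  then show ?case
    using mat_diag_mult_left[OF G] by (intro eq_matI) auto
next
  case (Suc l)
  let ?M = "mat r \<rho> (\<lambda>(i, c). (\<nu> (Suc l) - \<tau> (Suc l)) / (f i - \<nu> (Suc l)) *
    (\<Prod>t\<in>{1..l}. (f i - \<tau> t) / (f i - \<nu> t)) * G $$ (i, c))"
  have IH: "fadi_Z (mat_diag r f) G \<tau> \<nu> (Suc l) = ?M"
    using Suc.prems by (intro Suc.IH) auto
  have "inv_mat (shifted (mat_diag r f) (\<nu> (Suc l + 1))) = mat_diag r (\<lambda>i. 1 / (f i - \<nu> (Suc l + 1)))"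
    using Suc.prems by (intro inv_mat_shifted) auto
  moreover have "\<nu> (Suc l) - \<tau> (Suc l) \<noteq> 0"
    using Suc.prems(2)[of "Suc l"] by auto
  moreover have "?M \<in> carrier_mat r \<rho>" by simp
  note mat_diag_mult_left[OF this]
  ultimately show ?case
    unfolding fadi_Z.simps Let_def IH shifted_mat_diag[of r f "\<tau> (Suc l)"]
    by (intro eq_matI) (auto simp: mat_diag_diag ac_simps)
qed

text \<open>The scalar is written as a single \<open>cnj\<close>, which the adjoint in
  \<open>fadi\<close> undoes, leaving a rational function of g i itself.\<close>

lemma fadi_W_diag:
  assumes H: "H \<in> carrier_mat r \<rho>"
    and ne: "\<And>i j. i < r \<Longrightarrow> j \<in> {1..Suc l} \<Longrightarrow> g i \<noteq> \<tau> j"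
  shows "fadi_W (mat_diag r g) H \<tau> \<nu> (Suc l) = mat r \<rho> (\<lambda>(i, c).
    cnj (1 / (g i - \<tau> (Suc l)) * (\<Prod>t\<in>{1..l}. (g i - \<nu> t) / (g i - \<tau> t))) * H $$ (i, c))"
  using ne
proof (induction l)
  case 0
  have "inv_mat (shifted (mat_diag r (\<lambda>i. cnj (g i))) (cnj (\<tau> 1))) = mat_diag r (\<lambda>i. 1 / (cnj (g i) - cnj (\<tau> 1)))"
    using 0 by (intro inv_mat_shifted) auto
  then show ?case
    using mat_diag_mult_left[OF H] by (intro eq_matI) (auto simp: mat_adjoint_mat_diag)
next
  case (Suc l)
  let ?M = "mat r \<rho> (\<lambda>(i, c). cnj (1 / (g i - \<tau> (Suc l)) *
    (\<Prod>t\<in>{1..l}. (g i - \<nu> t) / (g i - \<tau> t))) * H $$ (i, c))"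
  have IH: "fadi_W (mat_diag r g) H \<tau> \<nu> (Suc l) = ?M"
    using Suc.prems by (intro Suc.IH) auto
  have "inv_mat (shifted (mat_diag r (\<lambda>i. cnj (g i))) (cnj (\<tau> (Suc l + 1))))
      = mat_diag r (\<lambda>i. 1 / (cnj (g i) - cnj (\<tau> (Suc l + 1))))"
    using Suc.prems by (intro inv_mat_shifted) auto
  moreover have "?M \<in> carrier_mat r \<rho>" by simp
  note mat_diag_mult_left[OF this]
  ultimately show ?case
    unfolding fadi_W.simps Let_def IH mat_adjoint_mat_diag conjugate_complex_def shifted_mat_diag[of r _ "cnj (\<nu> (Suc l))"]
    by (intro eq_matI) (auto simp: mat_diag_diag ac_simps)
qed

text \<open>Column c of a block row is column c mod p of block c div p; this regroups the sum by
  blocks.\<close>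

lemma sum_lessThan_mult_div_mod:
  fixes F :: "nat \<Rightarrow> nat \<Rightarrow> 'a::comm_monoid_add"
  shows "(\<Sum>c<k * p. F (c div p) (c mod p)) = (\<Sum>j<k. \<Sum>c<p. F j c)"
proof -
  have "(\<Sum>c<k * p. F (c div p) (c mod p)) = (\<Sum>j<k. \<Sum>c\<in>{j * p..<j * p + p}. F (c div p) (c mod p))"
    by (rule sum.nat_group[symmetric])
  also have "\<dots> = (\<Sum>j<k. \<Sum>c<p. F j c)"
  proof (rule sum.cong[OF refl])
    fix j
    show "(\<Sum>c\<in>{j * p..<j * p + p}. F (c div p) (c mod p)) = (\<Sum>c<p. F j c)"
      unfolding sum.atLeastLessThan_shift_0[of _ "j * p"] lessThan_atLeast0
      by (intro sum.cong) (auto simp: add.commute)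
  qed
  finally show ?thesis .
qed

text \<open>By (l - u)(\<nu> - \<tau>) = (l - \<nu>)(u - \<tau>) - (l - \<tau>)(u - \<nu>), each
  summand times l - u is the difference of two consecutive partial products.\<close>

lemma fadi_telescope:
  fixes l u :: "'a::field"
  assumes "\<And>j. j \<in> {1..k} \<Longrightarrow> l \<noteq> \<nu> j" "\<And>j. j \<in> {1..k} \<Longrightarrow> u \<noteq> \<tau> j"
  shows "(l - u) * (\<Sum>j<k. ((\<nu> (Suc j) - \<tau> (Suc j)) / (l - \<nu> (Suc j)) * (\<Prod>t\<in>{1..j}. (l - \<tau> t) / (l - \<nu> t))) *
      (1 / (u - \<tau> (Suc j)) * (\<Prod>t\<in>{1..j}. (u - \<nu> t) / (u - \<tau> t))))
    = 1 - (\<Prod>j\<in>{1..k}. (l - \<tau> j) * (u - \<nu> j) / ((l - \<nu> j) * (u - \<tau> j)))"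
  using assms
proof (induction k)
  case (Suc k)
  define P where "P = (\<Prod>j\<in>{1..k}. (l - \<tau> j) * (u - \<nu> j) / ((l - \<nu> j) * (u - \<tau> j)))"
  have P: "(\<Prod>t\<in>{1..k}. (l - \<tau> t) / (l - \<nu> t)) * (\<Prod>t\<in>{1..k}. (u - \<nu> t) / (u - \<tau> t)) = P"
    unfolding P_def prod.distrib[symmetric] by simp
  define \<tau>' \<nu>' where "\<tau>' = \<tau> (Suc k)" "\<nu>' = \<nu> (Suc k)"
  have ne: "l - \<nu>' \<noteq> 0" "u - \<tau>' \<noteq> 0" using Suc.prems[of "Suc k"] by (auto simp: \<tau>'_\<nu>'_def)
  have "(l - u) * (\<nu>' - \<tau>') = (l - \<nu>') * (u - \<tau>') - (l - \<tau>') * (u - \<nu>')"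
    by (simp add: algebra_simps)
  then have "(l - u) * ((\<nu>' - \<tau>') / (l - \<nu>') * (1 / (u - \<tau>'))) =
      ((l - \<nu>') * (u - \<tau>') - (l - \<tau>') * (u - \<nu>')) / ((l - \<nu>') * (u - \<tau>'))"
    by simp
  also have "\<dots> = 1 - (l - \<tau>') * (u - \<nu>') / ((l - \<nu>') * (u - \<tau>'))"
    using ne by (simp add: diff_divide_distrib)
  finally have step: "(l - u) * ((\<nu>' - \<tau>') / (l - \<nu>') * (1 / (u - \<tau>'))) * P =
      P - P * ((l - \<tau>') * (u - \<nu>') / ((l - \<nu>') * (u - \<tau>')))"
    by (simp only: left_diff_distrib mult_1 mult.commute[of P])
  have "(l - u) * (((\<nu>' - \<tau>') / (l - \<nu>') * (\<Prod>t\<in>{1..k}. (l - \<tau> t) / (l - \<nu> t))) *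
      (1 / (u - \<tau>') * (\<Prod>t\<in>{1..k}. (u - \<nu> t) / (u - \<tau> t))))
      = (l - u) * ((\<nu>' - \<tau>') / (l - \<nu>') * (1 / (u - \<tau>'))) * P"
    unfolding P[symmetric] by (simp only: mult_ac)
  note new = this[unfolded step]
  have old: "(l - u) * (\<Sum>j<k. ((\<nu> (Suc j) - \<tau> (Suc j)) / (l - \<nu> (Suc j)) * (\<Prod>t\<in>{1..j}. (l - \<tau> t) / (l - \<nu> t))) *
      (1 / (u - \<tau> (Suc j)) * (\<Prod>t\<in>{1..j}. (u - \<nu> t) / (u - \<tau> t)))) = 1 - P"
    unfolding P_def using Suc.prems by (intro Suc.IH) auto
  have "(\<Prod>j\<in>{1..Suc k}. (l - \<tau> j) * (u - \<nu> j) / ((l - \<nu> j) * (u - \<tau> j))) =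
      P * ((l - \<tau>') * (u - \<nu>') / ((l - \<nu>') * (u - \<tau>')))"
    by (simp add: P_def \<tau>'_\<nu>'_def)
  then show ?case
    unfolding sum.lessThan_Suc distrib_left old \<tau>'_\<nu>'_def[symmetric] new by simp
qed simp

text \<open>The solution X does not occur here. It enters when the entry of G H^* is replaced by (f
  a - g b) X; the product is then the relative error of the entry.\<close>

lemma fadi_diag_index:
  assumes G: "G \<in> carrier_mat r \<rho>" and H: "H \<in> carrier_mat s \<rho>"
    and f: "\<And>i j. i < r \<Longrightarrow> j \<in> {1..k} \<Longrightarrow> f i \<noteq> \<nu> j"
    and g: "\<And>i j. i < s \<Longrightarrow> j \<in> {1..k} \<Longrightarrow> g i \<noteq> \<tau> j"
    and ne: "\<And>j. j \<in> {1..k} \<Longrightarrow> \<tau> j \<noteq> \<nu> j"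
    and a: "a < r" and b: "b < s"
  shows "(f a - g b) * fadi (mat_diag r f) (mat_diag s g) G H \<tau> \<nu> k $$ (a, b) =
    (1 - (\<Prod>j\<in>{1..k}. (f a - \<tau> j) * (g b - \<nu> j) / ((f a - \<nu> j) * (g b - \<tau> j)))) * (G * mat_adjoint H) $$ (a, b)"
proof -
  define z where "z = (\<lambda>j. (\<nu> (Suc j) - \<tau> (Suc j)) / (f a - \<nu> (Suc j)) * (\<Prod>t\<in>{1..j}. (f a - \<tau> t) / (f a - \<nu> t)))"
  define w where "w = (\<lambda>j. 1 / (g b - \<tau> (Suc j)) * (\<Prod>t\<in>{1..j}. (g b - \<nu> t) / (g b - \<tau> t)))"
  have Z: "fadi_Z (mat_diag r f) G \<tau> \<nu> (Suc j) $$ (a, c) = z j * G $$ (a, c)" if "j < k" "c < \<rho>" for j c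
    using that a f ne by (subst fadi_Z_diag[OF G]) (auto simp: z_def)
  have W: "fadi_W (mat_diag s g) H \<tau> \<nu> (Suc j) $$ (b, c) = cnj (w j) * H $$ (b, c)" if "j < k" "c < \<rho>" for j c
    using that b g by (subst fadi_W_diag[OF H]) (auto simp: w_def)
  have dims: "dim_col G = \<rho>" "dim_col H = \<rho>" "dim_row H = s" "dim_row G = r" using G H by auto
  have md: "dim_row (mat_diag r f) = r" "dim_row (mat_diag s g) = s" by (simp_all add: mat_diag_def)
  have GH: "(G * mat_adjoint H) $$ (a, b) = (\<Sum>c<\<rho>. G $$ (a, c) * cnj (H $$ (b, c)))"
    using a b dims by (simp add: scalar_prod_def index_mat_adjoint lessThan_atLeast0)
  have "fadi (mat_diag r f) (mat_diag s g) G H \<tau> \<nu> k $$ (a, b) =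
      (\<Sum>c<k * \<rho>. fadi_Z (mat_diag r f) G \<tau> \<nu> (Suc (c div \<rho>)) $$ (a, c mod \<rho>) *
        cnj (fadi_W (mat_diag s g) H \<tau> \<nu> (Suc (c div \<rho>)) $$ (b, c mod \<rho>)))"
    using a b by (simp add: fadi_def block_row_def dims md scalar_prod_def index_mat_adjoint lessThan_atLeast0)
  also have "\<dots> = (\<Sum>j<k. \<Sum>c<\<rho>. fadi_Z (mat_diag r f) G \<tau> \<nu> (Suc j) $$ (a, c) *
        cnj (fadi_W (mat_diag s g) H \<tau> \<nu> (Suc j) $$ (b, c)))"
    by (rule sum_lessThan_mult_div_mod)
  also have "\<dots> = (\<Sum>j<k. \<Sum>c<\<rho>. (z j * w j) * (G $$ (a, c) * cnj (H $$ (b, c))))"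
    by (intro sum.cong refl) (auto simp: Z W)
  also have "\<dots> = (\<Sum>j<k. z j * w j) * (G * mat_adjoint H) $$ (a, b)"
    unfolding GH by (simp only: sum_product)
  finally have "(f a - g b) * fadi (mat_diag r f) (mat_diag s g) G H \<tau> \<nu> k $$ (a, b) =
      ((f a - g b) * (\<Sum>j<k. z j * w j)) * (G * mat_adjoint H) $$ (a, b)" by simp
  also have "(f a - g b) * (\<Sum>j<k. z j * w j) =
      1 - (\<Prod>j\<in>{1..k}. (f a - \<tau> j) * (g b - \<nu> j) / ((f a - \<nu> j) * (g b - \<tau> j)))"
    unfolding z_def w_def using f[OF a] g[OF b] by (intro fadi_telescope) auto
  finally show ?thesis .
qed

section \<open>The spectral norm under diagonal scaling\<close>

lemma l2norm_nonneg: "0 \<le> l2norm v"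
  by (simp add: l2norm_def L2_set_nonneg)

lemma l2norm_zero_vec: "l2norm (0\<^sub>v r) = 0"
  unfolding l2norm_def by (subst L2_set_eq_0_iff) auto

lemma l2norm_smult: "l2norm (c \<cdot>\<^sub>v v) = cmod c * l2norm v"
proof -
  have "l2norm (c \<cdot>\<^sub>v v) = L2_set (\<lambda>i. cmod c * cmod (vec_index v i)) {..<dim_vec v}"
    unfolding l2norm_def by (intro L2_set_cong) (auto simp: norm_mult)
  also have "\<dots> = cmod c * l2norm v"
    unfolding l2norm_def by (rule L2_set_right_distrib[symmetric]) simp
  finally show ?thesis .
qed

lemma l2norm_scaled_le:
  assumes "dim_vec w = dim_vec v" "0 \<le> c" "\<And>i. i < dim_vec v \<Longrightarrow> cmod (vec_index w i) \<le> c * cmod (vec_index v i)"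
  shows "l2norm w \<le> c * l2norm v"
proof -
  have "l2norm w \<le> L2_set (\<lambda>i. c * cmod (vec_index v i)) {..<dim_vec v}"
    unfolding l2norm_def assms(1) using assms(3) by (intro L2_set_mono) auto
  then show ?thesis
    unfolding l2norm_def using assms(2) by (simp add: L2_set_right_distrib)
qed

text \<open>A real supremum bounds its members only when the set is bounded; the sum of the absolute
  values of all entries serves as a crude bound.\<close>

lemma bdd_above_spectral_norm:
  "bdd_above ((\<lambda>v. l2norm (A *\<^sub>v v)) ` {v \<in> carrier_vec (dim_col A). l2norm v \<le> 1})"
proof (rule bdd_aboveI2)
  fix v assume v: "v \<in> {v \<in> carrier_vec (dim_col A). l2norm v \<le> 1}"
  then have dim: "dim_vec v = dim_col A" by auto
  have v1: "cmod (vec_index v j) \<le> 1" if "j < dim_col A" for j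
  proof -
    have "cmod (vec_index v j) \<le> l2norm v"
      unfolding l2norm_def using that dim
      by (intro member_le_L2_set) auto
    with v show ?thesis by simp
  qed
  have "l2norm (A *\<^sub>v v) \<le> (\<Sum>i<dim_row A. cmod (vec_index (A *\<^sub>v v) i))"
    unfolding l2norm_def dim_mult_mat_vec by (rule L2_set_le_sum) simp
  also have "\<dots> \<le> (\<Sum>i<dim_row A. \<Sum>j<dim_col A. cmod (A $$ (i, j)))"
  proof (rule sum_mono)
    fix i assume i: "i \<in> {..<dim_row A}"
    have "cmod (vec_index (A *\<^sub>v v) i) = cmod (\<Sum>j<dim_col A. A $$ (i, j) * vec_index v j)"
      using i dim by (simp add: scalar_prod_def lessThan_atLeast0)
    also have "\<dots> \<le> (\<Sum>j<dim_col A. cmod (A $$ (i, j) * vec_index v j))"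
      by (rule norm_sum)
    also have "\<dots> \<le> (\<Sum>j<dim_col A. cmod (A $$ (i, j)))"
      using v1 by (intro sum_mono) (simp add: norm_mult mult_left_le)
    finally show "cmod (vec_index (A *\<^sub>v v) i) \<le> (\<Sum>j<dim_col A. cmod (A $$ (i, j)))" .
  qed
  finally show "l2norm (A *\<^sub>v v) \<le> (\<Sum>i<dim_row A. \<Sum>j<dim_col A. cmod (A $$ (i, j)))" .
qed

lemma spectral_norm_upper:
  assumes "v \<in> carrier_vec (dim_col A)" "l2norm v \<le> 1"
  shows "l2norm (A *\<^sub>v v) \<le> spectral_norm A"
  unfolding spectral_norm_def using assms bdd_above_spectral_norm by (intro cSUP_upper) auto

lemma spectral_norm_nonneg: "0 \<le> spectral_norm A"
  using spectral_norm_upper[of "0\<^sub>v (dim_col A)" A] l2norm_nonneg[of "A *\<^sub>v 0\<^sub>v (dim_col A)"]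
  by (simp add: l2norm_zero_vec)

lemma l2norm_mult_mat_vec_le:
  assumes v: "v \<in> carrier_vec (dim_col A)"
  shows "l2norm (A *\<^sub>v v) \<le> spectral_norm A * l2norm v"
proof (cases "l2norm v = 0")
  case True
  have "vec_index v i = 0" if "i < dim_vec v" for i
    using True that unfolding l2norm_def by (subst (asm) L2_set_eq_0_iff) auto
  then have "v = 0 \<cdot>\<^sub>v v" by (intro eq_vecI) auto
  then have "A *\<^sub>v v = 0 \<cdot>\<^sub>v (A *\<^sub>v v)"
    using mult_mat_vec[of A "dim_row A" "dim_col A" v 0] v by (metis carrier_matI)
  then have "l2norm (A *\<^sub>v v) = 0"
    using l2norm_smult[of 0 "A *\<^sub>v v"] by simp
  then show ?thesis using True by simp
next
  case False
  then have pos: "0 < l2norm v" using l2norm_nonneg[of v] by linarith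
  define c where "c = complex_of_real (1 / l2norm v)"
  have c: "cmod c = 1 / l2norm v" using pos by (simp add: c_def norm_divide)
  have "l2norm (A *\<^sub>v (c \<cdot>\<^sub>v v)) \<le> spectral_norm A"
    using v pos by (intro spectral_norm_upper) (auto simp: l2norm_smult c)
  also have "A *\<^sub>v (c \<cdot>\<^sub>v v) = c \<cdot>\<^sub>v (A *\<^sub>v v)"
    using v by (intro mult_mat_vec) auto
  finally show ?thesis using pos by (simp add: l2norm_smult c divide_le_eq)
qed

text \<open>The scaled matrix is diag(d) X diag(e), so the norm grows by at most the product of the
  two maxima. For a general entrywise multiplier, a bound on its entries would not give
  this.\<close>

lemma spectral_norm_diag_scaling_le:
  assumes X: "X \<in> carrier_mat r s" and "0 < r" "0 < s"
    and C: "\<And>a b. a < r \<Longrightarrow> b < s \<Longrightarrow> cmod (d a) * cmod (e b) \<le> C"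
  shows "spectral_norm (mat r s (\<lambda>(a, b). d a * e b * X $$ (a, b))) \<le> C * spectral_norm X"
proof -
  let ?E = "mat r s (\<lambda>(a, b). d a * e b * X $$ (a, b))"
  define c1 where "c1 = Max ((\<lambda>a. cmod (d a)) ` {..<r})"
  define c2 where "c2 = Max ((\<lambda>b. cmod (e b)) ` {..<s})"
  have c1_ge: "cmod (d a) \<le> c1" if "a < r" for a
    unfolding c1_def using that by (intro Max_ge) auto
  have c2_ge: "cmod (e b) \<le> c2" if "b < s" for b
    unfolding c2_def using that by (intro Max_ge) auto
  \<comment> \<open>The maxima are attained at some row and some column, so the hypothesis, which
    bounds only products, applies to \<open>c1 * c2\<close>.\<close>
  have "c1 \<in> (\<lambda>a. cmod (d a)) ` {..<r}" "c2 \<in> (\<lambda>b. cmod (e b)) ` {..<s}"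
    unfolding c1_def c2_def using assms by (intro Max_in; auto)+
  then have c: "0 \<le> c1" "0 \<le> c2" "c1 * c2 \<le> C"
    using C by auto
  show ?thesis
    unfolding spectral_norm_def[of ?E]
  proof (rule cSUP_least)
    show "{v \<in> carrier_vec (dim_col ?E). l2norm v \<le> 1} \<noteq> {}"
      by (auto intro!: exI[of _ "0\<^sub>v s"] simp: l2norm_zero_vec)
  next
    fix v assume v: "v \<in> {v \<in> carrier_vec (dim_col ?E). l2norm v \<le> 1}"
    define w where "w = vec s (\<lambda>b. e b * vec_index v b)"
    have "l2norm w \<le> c2 * l2norm v"
      using v c c2_ge by (intro l2norm_scaled_le) (auto simp: w_def norm_mult intro!: mult_right_mono)
    also have "\<dots> \<le> c2" using v c by (intro mult_left_le) auto
    finally have w: "l2norm w \<le> c2" .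
    have Ev: "vec_index (?E *\<^sub>v v) a = d a * vec_index (X *\<^sub>v w) a" if "a < r" for a
    proof -
      have "dim_vec v = s" "dim_row X = r" "dim_col X = s" using v X by auto
      then show ?thesis
        using that by (auto simp: scalar_prod_def w_def sum_distrib_left intro!: sum.cong)
    qed
    have "l2norm (?E *\<^sub>v v) \<le> c1 * l2norm (X *\<^sub>v w)"
      using X c c1_ge Ev by (intro l2norm_scaled_le) (auto simp: norm_mult simp del: index_mult_mat_vec intro!: mult_right_mono)
    also have "\<dots> \<le> c1 * (spectral_norm X * l2norm w)"
      using X c by (intro mult_left_mono l2norm_mult_mat_vec_le) (auto simp: w_def)
    also have "\<dots> \<le> c1 * (spectral_norm X * c2)"
      using w c spectral_norm_nonneg by (intro mult_left_mono) auto
    also have "\<dots> = c1 * c2 * spectral_norm X" by simp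
    also have "\<dots> \<le> C * spectral_norm X"
      using c spectral_norm_nonneg by (intro mult_right_mono) auto
    finally show "l2norm (?E *\<^sub>v v) \<le> C * spectral_norm X" .
  qed
qed

section \<open>The spectra of the diagonal blocks and the error bound\<close>

lemma omega_power_in_arc_K:
  assumes "0 < n" "i \<in> {k0..<k0 + m}"
  shows "omega n ^ (2 * i) \<in> arc_K n m {k0..<k0 + m}"
proof -
  have Min: "Min {k0..<k0 + m} = k0" using assms by (intro Min_eqI) auto
  \<comment> \<open>The angle relative to \<open>arc_theta\<close>, which is the angle of the mean
    index k0 + (m - 1) / 2.\<close>
  define t where "t = pi / real n * (2 * real i - 2 * real k0 - real m + 1)"
  have "omega n ^ (2 * i) = exp (\<i> * complex_of_real (arc_theta n m {k0..<k0 + m} + t))"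
    unfolding omega_def exp_of_nat_mult[symmetric]
    by (intro arg_cong[where f=exp]) (simp add: arc_theta_def Min t_def algebra_simps)
  moreover have "t \<in> {- arc_alpha n m..arc_alpha n m}"
  proof -
    have "- (real m - 1) \<le> 2 * real i - 2 * real k0 - real m + 1" "2 * real i - 2 * real k0 - real m + 1 \<le> real m - 1"
      using assms by auto
    then have "pi / real n * - (real m - 1) \<le> t" "t \<le> pi / real n * (real m - 1)"
      unfolding t_def by (intro mult_left_mono; simp)+
    then show ?thesis
      by (simp only: atLeastAtMost_iff arc_alpha_def mult_minus_right)
  qed
  ultimately show ?thesis unfolding arc_K_def by blast
qed

lemma omega_power_in_arc_J:
  assumes n: "0 < n" "2 * m \<le> n" and m: "0 < m"
    and i: "i \<in> {k0 + m..<k0 + 2 * m} \<or> m \<le> k0 \<and> i \<in> {k0 - m..<k0}"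
  shows "omega n ^ (2 * i) \<in> arc_J n m {k0..<k0 + m}"
proof -
  have Min: "Min {k0..<k0 + m} = k0" using m by (intro Min_eqI) auto
  \<comment> \<open>For a sibling to the left of K the relative angle is negative; a full turn, s =
    1, moves it into the range of \<open>arc_J\<close>.\<close>
  define s :: real where "s = (if k0 \<le> i then 0 else 1)"
  define t where "t = pi / real n * (2 * real i - 2 * real k0 - real m + 1 + 2 * real n * s)"
  have "omega n ^ (2 * i) = exp (\<i> * complex_of_real (pi / real n * (2 * real i)))"
    unfolding omega_def exp_of_nat_mult[symmetric]
    by (intro arg_cong[where f=exp]) (simp add: algebra_simps)
  also have "\<dots> = exp (\<i> * complex_of_real (pi / real n * (2 * real i) + 2 * pi * s))"
    by (auto simp: s_def distrib_left exp_add mult_ac)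
  also have "pi / real n * (2 * real i) + 2 * pi * s = arc_theta n m {k0..<k0 + m} + t"
    using n by (simp add: arc_theta_def Min t_def field_simps)
  finally have 1: "omega n ^ (2 * i) = exp (\<i> * complex_of_real (arc_theta n m {k0..<k0 + m} + t))" .
  \<comment> \<open>In units of pi / n the near end of the sibling is at distance exactly m + 1 from
    the centre of K; for the far end 2 m \<le> n is used.\<close>
  have "real m + 1 \<le> 2 * real i - 2 * real k0 - real m + 1 + 2 * real n * s"
    "2 * real i - 2 * real k0 - real m + 1 + 2 * real n * s \<le> 2 * real n - (real m + 1)"
    using i n m by (auto simp: s_def)
  then have "pi / real n * (real m + 1) \<le> t" "t \<le> pi / real n * (2 * real n - (real m + 1))"
    unfolding t_def by (intro mult_left_mono; simp)+
  moreover have "pi / real n * (2 * real n - (real m + 1)) = 2 * pi - pi / real n * (real m + 1)"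
    using n by (simp add: right_diff_distrib)
  ultimately have "t \<in> {arc_beta n m..2 * pi - arc_beta n m}" by (simp add: arc_beta_def)
  with 1 show ?thesis unfolding arc_J_def by blast
qed

text \<open>The pair is unordered, so K may be either half; its first index k0 describes both cases
  at once.\<close>

lemma hodlr_siblingsE:
  assumes "hodlr_siblings n m J K" "2 \<le> m"
  obtains k0 where "K = {k0..<k0 + m}"
    and "\<And>i. i \<in> J \<Longrightarrow> i \<in> {k0 + m..<k0 + 2 * m} \<or> m \<le> k0 \<and> i \<in> {k0 - m..<k0}"
    and "J \<subseteq> {..<n}" "K \<subseteq> {..<n}" "card J = m" "card K = m" "2 * m \<le> n"
proof -
  obtain q where q: "(2 * q + 2) * m \<le> n"
    and JK: "{J, K} = {{2 * q * m..<(2 * q + 1) * m}, {(2 * q + 1) * m..<(2 * q + 2) * m}}"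
    using assms(1) unfolding hodlr_siblings_def by blast
  define s where "s = 2 * q * m"
  have s: "(2 * q + 1) * m = s + m" "(2 * q + 2) * m = s + 2 * m"
    by (auto simp: s_def algebra_simps)
  from JK have "J = {s..<s + m} \<and> K = {s + m..<s + 2 * m} \<or> J = {s + m..<s + 2 * m} \<and> K = {s..<s + m}"
    unfolding s s_def[symmetric] doubleton_eq_iff by blast
  then show thesis
  proof
    assume *: "J = {s..<s + m} \<and> K = {s + m..<s + 2 * m}"
    show thesis by (rule that[of "s + m"]) (use * q s in auto)
  next
    assume *: "J = {s + m..<s + 2 * m} \<and> K = {s..<s + m}"
    show thesis by (rule that[of s]) (use * q s in auto)
  qed
qed

theorem corollary3p1:
  fixes n m \<rho> k :: nat
    and C G H X Xk :: "complex mat"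
    and J K :: "nat set"
    and T :: "complex \<Rightarrow> complex"
    and \<xi> :: real
  assumes "\<exists>p. n = 2 ^ p"
    and "C \<in> carrier_mat n n"
    and "G \<in> carrier_mat n \<rho>"
    and "H \<in> carrier_mat n \<rho>"
    and "D_full n * C - C * D_full n = G * mat_adjoint H"
    and "hodlr_siblings n m J K"
    and "m \<ge> 2"
    and "X = submatrix C J K"
    and "k \<ge> 1"
    and "zol_moebius n m K T"
    and "Xk = fadi (D_sub n J) (D_sub n K) (submatrix G J UNIV) (submatrix H K UNIV)
                (zol_tau n m T k) (zol_nu n m T k) k"
    and "\<xi> = exp (pi\<^sup>2 / (2 * ln (4 * real m)))"
  shows "D_sub n J * X - X * D_sub n K = submatrix G J UNIV * mat_adjoint (submatrix H K UNIV)
    \<and> vec_space.rank m (submatrix G J UNIV * mat_adjoint (submatrix H K UNIV)) \<le> \<rho>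
    \<and> vec_space.rank m Xk \<le> \<rho> * k
    \<and> spectral_norm (X - Xk) \<le> 4 * \<xi> powi (- int k) * spectral_norm X
    \<and> \<xi> > 1"
proof -
  obtain k0 where K: "K = {k0..<k0 + m}"
    and J: "\<And>i. i \<in> J \<Longrightarrow> i \<in> {k0 + m..<k0 + 2 * m} \<or> m \<le> k0 \<and> i \<in> {k0 - m..<k0}"
    and sub: "J \<subseteq> {..<n}" "K \<subseteq> {..<n}" and card: "card J = m" "card K = m" and n: "2 * m \<le> n"
    using hodlr_siblingsE[OF assms(6,7)] by metis
  have m: "0 < m" "0 < n" using assms(7) n by auto
  have JK_eq: "{i. i < n \<and> i \<in> J} = J" "{i. i < n \<and> i \<in> K} = K"
    using sub by auto
  have pick_J: "pick J a \<in> J" "pick J a < n" if "a < m" for a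
    using pick_in_set_le[of a J] sub card that by auto
  have pick_K: "pick K b \<in> K" "pick K b < n" if "b < m" for b
    using pick_in_set_le[of b K] sub card that by auto
  define GJ HK where "GJ = submatrix G J UNIV" "HK = submatrix H K UNIV"
  note GJ_HK = this
  define f where "f = (\<lambda>a. omega n ^ (2 * pick J a))"
  define g where "g = (\<lambda>b. omega n ^ (2 * pick K b))"
  define \<tau> \<nu> where "\<tau> = zol_tau n m T k" "\<nu> = zol_nu n m T k"
  note \<tau>\<nu> = this
  have D_J: "D_sub n J = mat_diag m f" and D_K: "D_sub n K = mat_diag m g"
    by (simp_all add: D_sub_def card f_def g_def)
  have GJ: "GJ \<in> carrier_mat m \<rho>" and HK: "HK \<in> carrier_mat m \<rho>"
    using assms(3,4) by (auto simp: GJ_HK submatrix_def JK_eq card)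
  have X: "X \<in> carrier_mat m m"
    using assms(2) by (auto simp: assms(8) submatrix_def JK_eq card)
  have X_index: "X $$ (a, b) = C $$ (pick J a, pick K b)" if "a < m" "b < m" for a b
    using that assms(2) by (simp add: assms(8) submatrix_def JK_eq card)
  have G_index: "GJ $$ (a, c) = G $$ (pick J a, c)" and H_index: "HK $$ (a, c) = H $$ (pick K a, c)"
    if "a < m" "c < \<rho>" for a c
    using that assms(3,4) by (simp_all add: GJ_HK submatrix_def JK_eq card pick_UNIV)
  \<comment> \<open>Both outer factors are diagonal, so the displacement equation holds entry by
    entry and restricts to the block.\<close>
  have rhs: "(GJ * mat_adjoint HK) $$ (a, b) = (f a - g b) * X $$ (a, b)" if ab: "a < m" "b < m" for a b
  proof -
    let ?i = "pick J a" and ?j = "pick K b"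
    note ij = pick_J(2)[OF ab(1)] pick_K(2)[OF ab(2)]
    have "(GJ * mat_adjoint HK) $$ (a, b) = (\<Sum>c<\<rho>. G $$ (?i, c) * cnj (H $$ (?j, c)))"
      using ab GJ HK by (simp add: scalar_prod_def index_mat_adjoint lessThan_atLeast0 G_index H_index)
    also have "\<dots> = (G * mat_adjoint H) $$ (?i, ?j)"
      using ij assms(3,4) by (simp add: scalar_prod_def index_mat_adjoint lessThan_atLeast0)
    also have "\<dots> = (D_full n * C - C * D_full n) $$ (?i, ?j)"
      by (simp add: assms(5))
    also have "\<dots> = (f a - g b) * C $$ (?i, ?j)"
      using ij assms(2) unfolding D_full_def mat_diag_mult_left[OF assms(2)] mat_diag_mult_right[OF assms(2)]
      by (simp add: f_def g_def algebra_simps)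
    finally show ?thesis using ab by (simp add: X_index)
  qed
  have displacement: "D_sub n J * X - X * D_sub n K = GJ * mat_adjoint HK"
    unfolding D_J D_K mat_diag_mult_left[OF X] mat_diag_mult_right[OF X]
    by (intro eq_matI) (use GJ HK rhs in \<open>auto simp: algebra_simps simp del: index_mult_mat(1)\<close>)
  interpret vec_space "TYPE(complex)" m .
  have rank_rhs: "rank (GJ * mat_adjoint HK) \<le> \<rho>"
    using GJ HK by (intro rank_mult_le_inner_dim[where nc=m]) (auto intro!: carrier_matI)
  have Xk: "Xk = fadi (mat_diag m f) (mat_diag m g) GJ HK \<tau> \<nu> k"
    by (simp add: assms(11) D_J D_K GJ_HK \<tau>\<nu>)
  have dims: "dim_row (mat_diag m f) = m" "dim_row (mat_diag m g) = m" "dim_col GJ = \<rho>" "dim_col HK = \<rho>"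
    using GJ HK by (auto simp: mat_diag_def)
  have "rank Xk \<le> k * \<rho>"
    unfolding Xk fadi_def dims
    by (intro rank_mult_le_inner_dim[where nc=m]) (auto simp: block_row_def intro!: carrier_matI)
  then have rank_Xk: "rank Xk \<le> \<rho> * k" by (simp add: mult.commute)
  have f_arc: "f a \<in> arc_J n m K" if "a < m" for a
    unfolding f_def K using m n J[OF pick_J(1)[OF that]] by (intro omega_power_in_arc_J)
  have g_arc: "g b \<in> arc_K n m K" if "b < m" for b
    unfolding g_def using m pick_K(1)[OF that] unfolding K by (intro omega_power_in_arc_K)
  note ratio = zolotarev_ratio_le[OF assms(7) n assms(9,10), folded \<tau>\<nu>]
  \<comment> \<open>The error multiplier is split into a row function and a column function, the
    form that \<open>spectral_norm_diag_scaling_le\<close> takes.\<close>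
  define r where "r = (\<lambda>l. \<Prod>j\<in>{1..k}. (l - \<tau> j) / (l - \<nu> j))"
  define r' where "r' = (\<lambda>u. \<Prod>j\<in>{1..k}. (u - \<nu> j) / (u - \<tau> j))"
  have rr': "(\<Prod>j\<in>{1..k}. (l - \<tau> j) * (u - \<nu> j) / ((l - \<nu> j) * (u - \<tau> j))) = r l * r' u" for l u
    by (simp add: r_def r'_def prod.distrib[symmetric])
  have error: "X $$ (a, b) - Xk $$ (a, b) = r (f a) * r' (g b) * X $$ (a, b)" if ab: "a < m" "b < m" for a b
  proof -
    \<comment> \<open>Points of the two arcs never coincide, so the displacement factor can be
      cancelled below.\<close>
    have ne: "f a - g b \<noteq> 0"
      using ratio(5)[OF f_arc[OF ab(1)] g_arc[OF ab(2)]] by simp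
    have "(f a - g b) * Xk $$ (a, b) = (1 - r (f a) * r' (g b)) * ((f a - g b) * X $$ (a, b))"
      unfolding Xk rr'[symmetric] rhs[OF ab, symmetric]
    proof (rule fadi_diag_index[OF GJ HK _ _ _ ab])
      show "f i \<noteq> \<nu> j" if "i < m" "j \<in> {1..k}" for i j
        using ratio(2)[OF f_arc[OF that(1)] g_arc[OF ab(2)] that(2)] .
      show "g i \<noteq> \<tau> j" if "i < m" "j \<in> {1..k}" for i j
        using ratio(3)[OF f_arc[OF ab(1)] g_arc[OF that(1)] that(2)] .
      show "\<tau> j \<noteq> \<nu> j" if "j \<in> {1..k}" for j
        using ratio(4)[OF f_arc[OF ab(1)] g_arc[OF ab(2)] that] .
    qed
    then have "Xk $$ (a, b) = (1 - r (f a) * r' (g b)) * X $$ (a, b)"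
      using ne by simp
    then show ?thesis by (simp add: algebra_simps)
  qed
  define L where "L = ln (4 * real m)"
  have L: "0 < L" unfolding L_def using m by (intro ln_gt_zero) auto
  then have xi: "1 < \<xi>" by (simp add: assms(12) L_def[symmetric])
  have xi_k: "\<xi> powi (- int k) = exp (- (real k * pi\<^sup>2 / (2 * L)))"
    by (simp add: assms(12) L_def[symmetric] power_int_minus exp_minus flip: exp_of_nat_mult)
  have Xk_dim: "Xk \<in> carrier_mat m m"
    unfolding Xk fadi_def dims by (auto simp: block_row_def intro!: carrier_matI)
  have "X - Xk = mat m m (\<lambda>(a, b). r (f a) * r' (g b) * X $$ (a, b))"
    using X Xk_dim error by (intro eq_matI) auto
  also have "spectral_norm \<dots> \<le> 4 * \<xi> powi (- int k) * spectral_norm X"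
  proof (rule spectral_norm_diag_scaling_le[OF X m(1) m(1)])
    fix a b assume ab: "a < m" "b < m"
    show "cmod (r (f a)) * cmod (r' (g b)) \<le> 4 * \<xi> powi (- int k)"
      using ratio(1)[OF f_arc[OF ab(1)] g_arc[OF ab(2)]]
      unfolding rr' norm_mult xi_k L_def .
  qed
  finally show ?thesis
    using displacement rank_rhs rank_Xk xi unfolding GJ_HK by blast
qed

end
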